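(* Let $Y\in\widehat{\mathcal{SN}}_\omega$ be a transversally Hamiltonian doubly-resonant saddle-node. Then there exists a transversally symplectic formal diffeomorphism $\Phi\in\widehat{\mathrm{Diff}}_\omega$ such that $$\Phi_*(Y)=x^2\frac{\partial}{\partial x}+\big(-\lambda+a_1x-c(v)\big)y_1\frac{\partial}{\partial y_1}+\big(\lambda+a_2x+c(v)\big)y_2\frac{\partial}{\partial y_2},$$ where $v:=y_1y_2$. Here $\lambda\in\mathbb{C}^*$, $c(v)\in v\,\mathbb{C}[[v]]$ is a formal power series with null constant term, and $a_1,a_2\in\mathbb{C}$ are such that $a_1+a_2=\mathrm{res}(Y)=1$. Furthermore, this normal form is unique with respect to the action of $\widehat{\mathrm{Diff}}_\omega$; that is, if two vector fields of the displayed form, with data $(\lambda,a_1,a_2,c)$ and $(\lambda',a_1',a_2',c')$ respectively, are both $\widehat{\mathrm{Diff}}_\omega$-conjugate to $Y$, then $(\lambda,a_1,a_2,c)=(\lambda',a_1',a_2',c')$.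
   Context: Coordinates on $\mathbb{C}^3$ are $(x,\mathbf y)=(x,y_1,y_2)$; $\mathfrak m$ is the maximal ideal of $\mathbb{C}[[x,\mathbf y]]$. A singular formal vector field is one whose coefficients lie in $\mathfrak m$. $\widehat{\mathrm{Diff}}$ is the group of formal diffeomorphisms of $\mathbb{C}^3$ fixing the origin, acting on singular formal vector fields by $\Phi_*(Y)=(\mathrm D\Phi\cdot Y)\circ\Phi^{-1}$; for a subgroup $G$, two vector fields are $G$-conjugate if some $\Phi\in G$ sends one to the other by this action. $\langle \mathrm dx\rangle$ is the ideal generated by $\mathrm dx$ in the exterior algebra of formal differential forms with coefficients in $\mathbb{C}[[x,\mathbf y]]$. Put $\omega:=\frac{\mathrm dy_1\wedge\mathrm dy_2}{x}$. A singular formal vector field $Y$ is transversally Hamiltonian if $\mathcal L_Y(\mathrm dx)\in\langle\mathrm dx\rangle$ and $x\mathcal L_Y(\omega)\in\langle\mathrm dx\rangle$. Here the first condition implies $\mathcal L_Y(x)\in\langle x\rangle$ (the ideal generated by $x$), and the Lie derivative is extended to forms divided by $x$ by $\mathcal L_Y(\frac1x\theta)=-\frac{\mathcal L_Y(x)}{x^2}\theta+\frac1x\mathcal L_Y(\theta)$. The set of these vector fields is $\mathcal D_\omega$. A formal diffeomorphism $\Phi\in\widehat{\mathrm{Diff}}$ is transversally symplectic if $\Phi^*(x)=x$ and $x\Phi^*(\omega)\in x\omega+\langle\mathrm dx\rangle$, where $\Phi^*(\frac1x\theta)=\frac1x\Phi^*(\theta)$. The group of these is $\widehat{\mathrm{Diff}}_\omega$.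 Call a formal vector field prepared if it has the form $x^2\partial_x+(-\lambda y_1+F_1(x,\mathbf y))\partial_{y_1}+(\lambda y_2+F_2(x,\mathbf y))\partial_{y_2}$ with $\lambda\in\mathbb{C}^*$ and $F_1,F_2\in\mathfrak m^2$. A transversally Hamiltonian doubly-resonant saddle-node is an element $Y\in\mathcal D_\omega$ that is $\widehat{\mathrm{Diff}}_\omega$-conjugate to a prepared vector field; $\widehat{\mathcal{SN}}_\omega$ is the set of these. Residue: for a prepared vector field, let $\mathbf A(x)$ be the $2\times2$ matrix over $\mathbb{C}[[x]]$ giving the part linear in $\mathbf y$ of the vector of coefficients of $\partial_{y_1},\partial_{y_2}$ (expanded in powers of $\mathbf y$); then $\mathrm{res}(Y):=\left(\frac{\mathrm{Tr}\,\mathbf A(x)}{x}\right)_{|x=0}$. It is invariant under formal diffeomorphisms of the form $(x,\mathbf y)\mapsto(x,\phi(x,\mathbf y))$ and so is defined for every $Y\in\widehat{\mathcal{SN}}_\omega$ via a prepared conjugate; it always equals $1$ on $\widehat{\mathcal{SN}}_\omega$.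
   Formalization: Uniqueness is proved only up to the swap (λ,a₁,a₂,c(v)) ↦ (−λ,a₂,a₁,−c(−v)), induced by the transversally symplectic map (x,y₁,y₂) ↦ (x,y₂,−y₁); literal uniqueness is false, but the data are equal whenever λ'=λ. *)

theory Defs
  imports Complex_Main
    "HOL-Computational_Algebra.Formal_Power_Series"
    "HOL-Library.Function_Algebras"
begin

section \<open>Formal power series in three variables\<close>

text \<open>
  The ring of formal power series in \<open>x, y\<^sub>1, y\<^sub>2\<close> is the iterated power series ring, with \<open>x\<close> as
  the outermost variable and \<open>y\<^sub>2\<close> as the innermost one.
\<close>

type_synonym ser = "complex fps fps fps"

datatype coord = Cx | Cy1 | Cy2

definition cf :: "ser \<Rightarrow> nat \<Rightarrow> nat \<Rightarrow> nat \<Rightarrow> complex" where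
  "cf f i j k = fps_nth (fps_nth (fps_nth f i) j) k"

definition const :: "complex \<Rightarrow> ser" where
  "const a = fps_const (fps_const (fps_const a))"

fun var :: "coord \<Rightarrow> ser" where
  "var Cx = fps_X"
| "var Cy1 = fps_const fps_X"
| "var Cy2 = fps_const (fps_const fps_X)"

fun pderiv :: "coord \<Rightarrow> ser \<Rightarrow> ser" where
  "pderiv Cx f = fps_deriv f"
| "pderiv Cy1 f = Abs_fps (\<lambda>i. fps_deriv (fps_nth f i))"
| "pderiv Cy2 f = Abs_fps (\<lambda>i. Abs_fps (\<lambda>j. fps_deriv (fps_nth (fps_nth f i) j)))"

definition mideal :: "ser set" where
  "mideal = {f. cf f 0 0 0 = 0}"

definition mideal_sq :: "ser set" where
  "mideal_sq = {\<Sum>l<n. g l * h l | (n::nat) g h. \<forall>l<n. g l \<in> mideal \<and> h l \<in> mideal}"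

text \<open>
  Substitution of \<open>g Cx, g Cy1, g Cy2\<close> into \<open>f\<close>, meant for \<open>g c \<in> mideal\<close>. Then
  the monomial \<open>a, b, d\<close> of \<open>f\<close> contributes only in degree at least \<open>a + b + d\<close>, so that the
  coefficient at \<open>i, j, k\<close> is the finite sum below. The same remark applies to \<open>subst1\<close>,
  which substitutes into a series in one variable.
\<close>

definition subst :: "ser \<Rightarrow> (coord \<Rightarrow> ser) \<Rightarrow> ser" where
  "subst f g = Abs_fps (\<lambda>i. Abs_fps (\<lambda>j. Abs_fps (\<lambda>k.
     \<Sum>a\<le>i+j+k. \<Sum>b\<le>i+j+k. \<Sum>d\<le>i+j+k. cf f a b d * cf (g Cx ^ a * g Cy1 ^ b * g Cy2 ^ d) i j k)))"

definition subst1 :: "complex fps \<Rightarrow> ser \<Rightarrow> ser" where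
  "subst1 c v = Abs_fps (\<lambda>i. Abs_fps (\<lambda>j. Abs_fps (\<lambda>k.
     \<Sum>n\<le>i+j+k. fps_nth c n * cf (v ^ n) i j k)))"


section \<open>Formal diffeomorphisms and formal vector fields\<close>

definition dcomp :: "(coord \<Rightarrow> ser) \<Rightarrow> (coord \<Rightarrow> ser) \<Rightarrow> (coord \<Rightarrow> ser)" where
  "dcomp \<Phi> \<Psi> = (\<lambda>c. subst (\<Phi> c) \<Psi>)"

definition dinverse :: "(coord \<Rightarrow> ser) \<Rightarrow> (coord \<Rightarrow> ser) \<Rightarrow> bool" where
  "dinverse \<Phi> \<Psi> \<longleftrightarrow> (\<forall>c. \<Psi> c \<in> mideal) \<and> dcomp \<Phi> \<Psi> = var \<and> dcomp \<Psi> \<Phi> = var"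

definition Diff :: "(coord \<Rightarrow> ser) set" where
  "Diff = {\<Phi>. (\<forall>c. \<Phi> c \<in> mideal) \<and> (\<exists>\<Psi>. dinverse \<Phi> \<Psi>)}"

definition dinv :: "(coord \<Rightarrow> ser) \<Rightarrow> (coord \<Rightarrow> ser)" where
  "dinv \<Phi> = (THE \<Psi>. dinverse \<Phi> \<Psi>)"

text \<open>A formal vector field is given by its coefficients with respect to the coordinate fields.\<close>

definition vf :: "ser \<Rightarrow> ser \<Rightarrow> ser \<Rightarrow> (coord \<Rightarrow> ser)" where
  "vf a b d = (\<lambda>c. case c of Cx \<Rightarrow> a | Cy1 \<Rightarrow> b | Cy2 \<Rightarrow> d)"

definition singular :: "(coord \<Rightarrow> ser) \<Rightarrow> bool" where
  "singular Y \<longleftrightarrow> (\<forall>c. Y c \<in> mideal)"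

definition along :: "(coord \<Rightarrow> ser) \<Rightarrow> ser \<Rightarrow> ser" where
  "along Y f = (\<Sum>c\<in>{Cx, Cy1, Cy2}. Y c * pderiv c f)"

definition push :: "(coord \<Rightarrow> ser) \<Rightarrow> (coord \<Rightarrow> ser) \<Rightarrow> (coord \<Rightarrow> ser)" where
  "push \<Phi> Y = (\<lambda>c. subst (along Y (\<Phi> c)) (dinv \<Phi>))"

definition conjugate_by :: "(coord \<Rightarrow> ser) set \<Rightarrow> (coord \<Rightarrow> ser) \<Rightarrow> (coord \<Rightarrow> ser) \<Rightarrow> bool" where
  "conjugate_by G Y Z \<longleftrightarrow> (\<exists>\<Phi>\<in>G. push \<Phi> Y = Z)"


section \<open>Formal differential forms\<close>

text \<open>
  \<open>\<alpha> S\<close> is the coefficient of the wedge product of the differentials of the coordinates in \<open>S\<close>,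
  taken in the order \<open>x, y\<^sub>1, y\<^sub>2\<close>. For disjoint \<open>S\<close> and \<open>T\<close>, \<open>wsign S T\<close> is the sign with which
  the wedge product of the basis forms of \<open>S\<close> and \<open>T\<close> is the basis form of \<open>S \<union> T\<close>.
\<close>

type_synonym form = "coord set \<Rightarrow> ser"

fun crank :: "coord \<Rightarrow> nat" where
  "crank Cx = 0" | "crank Cy1 = 1" | "crank Cy2 = 2"

definition wsign :: "coord set \<Rightarrow> coord set \<Rightarrow> ser" where
  "wsign S T = (-1) ^ card {(c, d). c \<in> S \<and> d \<in> T \<and> crank d < crank c}"

definition form0 :: "ser \<Rightarrow> form" where
  "form0 f = (\<lambda>S. if S = {} then f else 0)"

definition smul :: "ser \<Rightarrow> form \<Rightarrow> form" where
  "smul f \<alpha> = (\<lambda>S. f * \<alpha> S)"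

definition wedge :: "form \<Rightarrow> form \<Rightarrow> form" where
  "wedge \<alpha> \<beta> = (\<lambda>S. \<Sum>T\<in>Pow S. wsign T (S - T) * \<alpha> T * \<beta> (S - T))"

definition ext_d :: "form \<Rightarrow> form" where
  "ext_d \<alpha> = (\<lambda>S. \<Sum>c\<in>S. wsign {c} (S - {c}) * pderiv c (\<alpha> (S - {c})))"

definition contract :: "(coord \<Rightarrow> ser) \<Rightarrow> form \<Rightarrow> form" where
  "contract Y \<alpha> = (\<lambda>S. \<Sum>c\<in>- S. wsign {c} S * Y c * \<alpha> (insert c S))"

definition lie :: "(coord \<Rightarrow> ser) \<Rightarrow> form \<Rightarrow> form" where
  "lie Y \<alpha> = ext_d (contract Y \<alpha>) + contract Y (ext_d \<alpha>)"

definition pullback :: "(coord \<Rightarrow> ser) \<Rightarrow> form \<Rightarrow> form" where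
  "pullback \<Phi> \<alpha> = (\<Sum>S\<in>Pow {Cx, Cy1, Cy2}. smul (subst (\<alpha> S) \<Phi>)
     (foldr wedge (map (\<lambda>c. ext_d (form0 (\<Phi> c))) (filter (\<lambda>c. c \<in> S) [Cx, Cy1, Cy2])) (form0 1)))"

definition dvar :: "coord \<Rightarrow> form" where
  "dvar c = ext_d (form0 (var c))"

text \<open>By graded commutativity the right multiples of \<open>dx\<close> already form the two-sided ideal.\<close>

definition dx_ideal :: "form set" where
  "dx_ideal = {wedge (dvar Cx) \<beta> | \<beta>. True}"

text \<open>
  \<open>Over_x \<theta>\<close> stands for the form \<open>\<theta> / x\<close>. In \<open>lie_over_x\<close>, \<open>fps_shift 1 (along Y (var Cx))\<close>
  is the quotient of \<open>\<L>\<^sub>Y(x)\<close> by \<open>x\<close>; this is meaningful only when \<open>x\<close> divides \<open>\<L>\<^sub>Y(x)\<close>.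
\<close>

datatype form_over_x = Over_x form

fun x_times :: "form_over_x \<Rightarrow> form" where
  "x_times (Over_x \<theta>) = \<theta>"

fun lie_over_x :: "(coord \<Rightarrow> ser) \<Rightarrow> form_over_x \<Rightarrow> form_over_x" where
  "lie_over_x Y (Over_x \<theta>) = Over_x (lie Y \<theta> - smul (fps_shift 1 (along Y (var Cx))) \<theta>)"

text \<open>Used only for \<open>\<Phi>\<close> with \<open>\<Phi>\<^sup>*(x) = x\<close>.\<close>

fun pullback_over_x :: "(coord \<Rightarrow> ser) \<Rightarrow> form_over_x \<Rightarrow> form_over_x" where
  "pullback_over_x \<Phi> (Over_x \<theta>) = Over_x (pullback \<Phi> \<theta>)"

definition omega :: form_over_x where
  "omega = Over_x (wedge (dvar Cy1) (dvar Cy2))"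


section \<open>Transversally Hamiltonian doubly-resonant saddle-nodes\<close>

definition D_omega :: "(coord \<Rightarrow> ser) set" where
  "D_omega = {Y. singular Y \<and> lie Y (dvar Cx) \<in> dx_ideal \<and> x_times (lie_over_x Y omega) \<in> dx_ideal}"

definition Diff_omega :: "(coord \<Rightarrow> ser) set" where
  "Diff_omega = {\<Phi> \<in> Diff. pullback \<Phi> (form0 (var Cx)) = form0 (var Cx) \<and>
     (\<exists>\<beta>\<in>dx_ideal. x_times (pullback_over_x \<Phi> omega) = x_times omega + \<beta>)}"

definition prepared :: "(coord \<Rightarrow> ser) \<Rightarrow> bool" where
  "prepared Y \<longleftrightarrow> (\<exists>lam F1 F2. lam \<noteq> 0 \<and> F1 \<in> mideal_sq \<and> F2 \<in> mideal_sq \<and>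
     Y = vf (var Cx ^ 2) (- const lam * var Cy1 + F1) (const lam * var Cy2 + F2))"

definition SN_omega :: "(coord \<Rightarrow> ser) set" where
  "SN_omega = {Y \<in> D_omega. \<exists>Z. conjugate_by Diff_omega Y Z \<and> prepared Z}"

text \<open>
  \<open>linear_part Y c d\<close>, for \<open>c, d\<close> among \<open>Cy1, Cy2\<close>, is the entry \<open>c, d\<close> of the matrix \<open>A(x)\<close>;
  the column \<open>Cx\<close> is a dummy. The trace of \<open>A(x)\<close> is divisible by \<open>x\<close> when \<open>Y\<close> is prepared.
\<close>

fun linear_part :: "(coord \<Rightarrow> ser) \<Rightarrow> coord \<Rightarrow> coord \<Rightarrow> complex fps" where
  "linear_part Y c Cy1 = Abs_fps (\<lambda>i. cf (Y c) i 1 0)"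
| "linear_part Y c Cy2 = Abs_fps (\<lambda>i. cf (Y c) i 0 1)"
| "linear_part Y c Cx = 0"

definition sn_residue_prepared :: "(coord \<Rightarrow> ser) \<Rightarrow> complex" where
  "sn_residue_prepared Z = fps_nth ((linear_part Z Cy1 Cy1 + linear_part Z Cy2 Cy2) / fps_X) 0"

definition sn_residue :: "(coord \<Rightarrow> ser) \<Rightarrow> complex" where
  "sn_residue Y = (THE r. \<exists>Z. conjugate_by Diff_omega Y Z \<and> prepared Z \<and> r = sn_residue_prepared Z)"

text \<open>
  The normal form is unique only up to the swap \<open>(x, y\<^sub>1, y\<^sub>2) \<mapsto> (x, y\<^sub>2, -y\<^sub>1)\<close>. This map lies in
  \<open>Diff_omega\<close> and sends \<open>normal_form lam a1 a2 c\<close> to the normal form with data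
  \<open>(-lam, a2, a1, -c(-v))\<close>; since \<open>lam \<noteq> 0\<close>, these data always differ from \<open>(lam, a1, a2, c)\<close>.
\<close>

definition normal_form :: "complex \<Rightarrow> complex \<Rightarrow> complex \<Rightarrow> complex fps \<Rightarrow> (coord \<Rightarrow> ser)" where
  "normal_form lam a1 a2 c = (let cv = subst1 c (var Cy1 * var Cy2) in
     vf (var Cx ^ 2)
        ((- const lam + const a1 * var Cx - cv) * var Cy1)
        ((const lam + const a2 * var Cx + cv) * var Cy2))"

end

theory Submission
  imports Defs
begin

text \<open>
  Let \<open>E = - y\<^sub>1 \<partial>\<^sub>1 + y\<^sub>2 \<partial>\<^sub>2\<close>, so that a prepared field is \<open>\<lambda> E\<close> plus terms of higher order. A
  transversally symplectic diffeomorphism fixes \<open>x\<close> and has Jacobian 1 in \<open>\<^bold>y\<close>, and an element of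
  \<open>D_omega\<close> with \<open>x\<close>-component \<open>x\<^sup>2\<close> has divergence \<open>x\<close> in \<open>\<^bold>y\<close>.

  Existence. The Poincare-Dulac equation is a fixed-point problem for a contraction in the
  \<open>m\<close>-adic topology; it yields a change of variables tangent to the identity, not
  symplectic in general, to a field \<open>Z\<close> commuting with \<open>E\<close>. The Jacobian, read in the new
  variables, satisfies \<open>Z P = (div Z - x) P\<close>, which forces \<open>E P = 0\<close>; hence it can be corrected by
  some \<open>(x, y\<^sub>1 u, y\<^sub>2)\<close> with \<open>E u = 0\<close>, which preserves commutation with \<open>E\<close>. Then \<open>div Z = x\<close> gives
  \<open>Z v = x v\<close>, and a symplectic map \<open>(x, y\<^sub>1 e\<^sup>g, y\<^sub>2 e\<^sup>-\<^sup>g)\<close> with \<open>E g = 0\<close> produces the normal form.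

  Uniqueness. If \<open>(x, \<theta>\<^sub>1, \<theta>\<^sub>2)\<close> conjugates two normal forms, the linear parts give \<open>\<lambda>' = \<plusminus> \<lambda>\<close>, and the
  swap reduces the sign \<open>-\<close> to the sign \<open>+\<close>. Then \<open>\<theta>\<^sub>1\<close> and \<open>w = \<theta>\<^sub>1 \<theta>\<^sub>2\<close> are eigenvectors of \<open>E\<close>, the
  equation \<open>N w = x w\<close> forces \<open>w = v\<close>, and comparing coefficients in the equation for \<open>\<theta>\<^sub>1\<close>
  identifies the remaining data.
\<close>

declare var.simps [simp del] pderiv.simps [simp del]

section \<open>Coefficients, constants and monomials\<close>

lemma ser_eqI: "(\<And>i j k. cf f i j k = cf g i j k) \<Longrightarrow> f = g"
  unfolding cf_def by (intro fps_ext)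

definition ser_of :: "(nat \<Rightarrow> nat \<Rightarrow> nat \<Rightarrow> complex) \<Rightarrow> ser" where
  "ser_of h = Abs_fps (\<lambda>i. Abs_fps (\<lambda>j. Abs_fps (h i j)))"

lemma cf_ser_of [simp]: "cf (ser_of h) i j k = h i j k"
  by (simp add: cf_def ser_of_def)

lemma cf_0 [simp]: "cf 0 i j k = 0"
  and cf_add [simp]: "cf (f + g) i j k = cf f i j k + cf g i j k"
  and cf_diff [simp]: "cf (f - g) i j k = cf f i j k - cf g i j k"
  and cf_minus [simp]: "cf (- f) i j k = - cf f i j k"
  and cf_sum: "cf (sum h A) i j k = (\<Sum>a\<in>A. cf (h a) i j k)"
  by (simp_all add: cf_def fps_sum_nth)

lemma cf_mult:
  "cf (f * g) i j k = (\<Sum>a\<le>i. \<Sum>b\<le>j. \<Sum>d\<le>k. cf f a b d * cf g (i - a) (j - b) (k - d))"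
  by (simp add: cf_def fps_mult_nth fps_sum_nth atLeast0AtMost)

lemma const_0 [simp]: "const 0 = 0" and const_1 [simp]: "const 1 = 1"
  by (simp_all add: const_def)

lemma const_add: "const (a + b) = const a + const b"
  and const_diff: "const (a - b) = const a - const b"
  and const_minus: "const (- a) = - const a"
  and const_mult: "const (a * b) = const a * const b"
  by (simp_all add: const_def)

lemma cf_const_mult [simp]: "cf (const a * f) i j k = a * cf f i j k"
  by (simp add: cf_def const_def)

lemma cf_const: "cf (const a) i j k = (if i = 0 \<and> j = 0 \<and> k = 0 then a else 0)"
  by (simp add: cf_def const_def)

lemma cf_1: "cf 1 i j k = (if i = 0 \<and> j = 0 \<and> k = 0 then 1 else 0)"
  using cf_const [of 1] by simp

definition monom :: "nat \<Rightarrow> nat \<Rightarrow> nat \<Rightarrow> ser" where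
  "monom i j k = var Cx ^ i * var Cy1 ^ j * var Cy2 ^ k"

lemma cf_monom: "cf (monom a b d) i j k = (if i = a \<and> j = b \<and> k = d then 1 else 0)"
  by (auto simp: cf_def monom_def var.simps fps_const_power fps_X_power_nth fps_mult_right_const_nth)

lemma monom_mult: "monom a b d * monom a' b' d' = monom (a + a') (b + b') (d + d')"
  by (simp add: monom_def power_add algebra_simps)

lemma monom_0 [simp]: "monom 0 0 0 = 1"
  by (simp add: monom_def)

lemma var_monom: "var Cx = monom 1 0 0" "var Cy1 = monom 0 1 0" "var Cy2 = monom 0 0 1"
  by (simp_all add: monom_def)

lemma cf_var:
  "cf (var Cx) i j k = (if i = 1 \<and> j = 0 \<and> k = 0 then 1 else 0)"
  "cf (var Cy1) i j k = (if i = 0 \<and> j = 1 \<and> k = 0 then 1 else 0)"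
  "cf (var Cy2) i j k = (if i = 0 \<and> j = 0 \<and> k = 1 then 1 else 0)"
  unfolding var_monom cf_monom by simp_all

lemma cf_var_mult:
  "cf (var Cx * f) i j k = (if i = 0 then 0 else cf f (i - 1) j k)"
  "cf (var Cy1 * f) i j k = (if j = 0 then 0 else cf f i (j - 1) k)"
  "cf (var Cy2 * f) i j k = (if k = 0 then 0 else cf f i j (k - 1))"
  by (auto simp: cf_def var.simps)

section \<open>The order filtration\<close>

text \<open>Membership in the \<open>N\<close>-th power of the maximal ideal, expressed through
  coefficients of low total degree.\<close>

definition ord_ge :: "nat \<Rightarrow> ser \<Rightarrow> bool" where
  "ord_ge N f \<longleftrightarrow> (\<forall>i j k. i + j + k < N \<longrightarrow> cf f i j k = 0)"

lemma ord_ge_0 [simp]: "ord_ge 0 f" and ord_ge_zero [simp]: "ord_ge N 0"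
  by (simp_all add: ord_ge_def)

lemma ord_ge_1: "ord_ge (Suc 0) f \<longleftrightarrow> f \<in> mideal"
  by (auto simp: ord_ge_def mideal_def)

lemma ord_ge_mono: "ord_ge N f \<Longrightarrow> M \<le> N \<Longrightarrow> ord_ge M f"
  by (auto simp: ord_ge_def)

lemma ord_ge_add: "ord_ge N f \<Longrightarrow> ord_ge N g \<Longrightarrow> ord_ge N (f + g)"
  and ord_ge_diff: "ord_ge N f \<Longrightarrow> ord_ge N g \<Longrightarrow> ord_ge N (f - g)"
  and ord_ge_minus: "ord_ge N f \<Longrightarrow> ord_ge N (- f)"
  by (simp_all add: ord_ge_def)

lemma ord_ge_sum: "(\<And>a. a \<in> A \<Longrightarrow> ord_ge N (h a)) \<Longrightarrow> ord_ge N (sum h A)"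
  by (simp add: ord_ge_def cf_sum)

lemma ord_ge_all_0: "(\<And>N. ord_ge N f) \<Longrightarrow> f = 0"
  by (rule ser_eqI) (auto simp: ord_ge_def)

lemma ord_ge_mult:
  assumes "ord_ge M f" "ord_ge N g"
  shows "ord_ge (M + N) (f * g)"
  unfolding ord_ge_def cf_mult
proof (intro allI impI sum.neutral ballI)
  fix i j k a b d
  assume "i + j + k < M + N" "a \<in> {..i}" "b \<in> {..j}" "d \<in> {..k}"
  then have "a + b + d < M \<or> (i - a) + (j - b) + (k - d) < N"
    by auto
  with assms show "cf f a b d * cf g (i - a) (j - b) (k - d) = 0"
    unfolding ord_ge_def by (metis mult_eq_0_iff)
qed

lemma ord_ge_mult_left: "ord_ge N g \<Longrightarrow> ord_ge N (f * g)"
  using ord_ge_mult [of 0 f N g] by simp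

lemma ord_ge_power: "f \<in> mideal \<Longrightarrow> ord_ge n (f ^ n)"
  using ord_ge_mult [of "Suc 0" f] by (induction n) (auto simp: ord_ge_1)

lemma ord_ge_var: "ord_ge (Suc 0) (var c)"
  by (cases c) (auto simp: ord_ge_def cf_var)

lemma var_mideal [simp]: "var c \<in> mideal"
  using ord_ge_var by (simp add: ord_ge_1)

lemma mideal_sq_ord_ge:
  assumes "f \<in> mideal_sq" shows "ord_ge 2 f"
proof -
  have "ord_ge (Suc 0 + Suc 0) (g * h)" if "g \<in> mideal" "h \<in> mideal" for g h
    using that by (intro ord_ge_mult) (auto simp: ord_ge_1)
  with assms show ?thesis
    unfolding mideal_sq_def by (auto intro!: ord_ge_sum simp: numeral_2_eq_2)
qed

text \<open>A box of exponents replaces a bound on the total degree: for density it is enough that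
  the finite part contains every monomial of degree below \<open>N\<close>.\<close>

definition trunc :: "nat \<Rightarrow> ser \<Rightarrow> ser" where
  "trunc N f = (\<Sum>i<N. \<Sum>j<N. \<Sum>k<N. const (cf f i j k) * monom i j k)"

lemma ord_ge_trunc: "ord_ge N (f - trunc N f)"
  unfolding ord_ge_def
proof (intro allI impI)
  fix i j k assume "i + j + k < N"
  then have *: "i < N" "j < N" "k < N" by auto
  have inner: "(\<Sum>d<N. cf f a b d * (if i = a \<and> j = b \<and> k = d then 1 else 0)) =
      (if b = j then if a = i then cf f a b k else 0 else 0)" for a b
    using * by (cases "a = i"; cases "b = j"; simp add: mult_delta_right)
  have "cf (trunc N f) i j k = (\<Sum>a<N. \<Sum>b<N. if b = j then if a = i then cf f a b k else 0 else 0)"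
    by (simp only: trunc_def cf_sum cf_const_mult cf_monom inner)
  also have "\<dots> = cf f i j k"
    using * by simp
  finally show "cf (f - trunc N f) i j k = 0" by simp
qed

text \<open>\<open>m\<close> is the loss of order of \<open>T\<close>: 0 for substitutions, 1 for derivatives.\<close>

lemma density:
  fixes T :: "ser \<Rightarrow> ser"
  assumes add: "\<And>f g. T (f + g) = T f + T g"
    and cont: "\<And>N f. ord_ge (N + m) f \<Longrightarrow> ord_ge N (T f)"
    and mon: "\<And>a i j k. T (const a * monom i j k) = 0"
  shows "T f = 0"
proof (rule ord_ge_all_0)
  fix N
  have T0: "T 0 = 0"
    using add [of 0 0] by simp
  have sum: "T (sum h A) = (\<Sum>a\<in>A. T (h a))" for h :: "nat \<Rightarrow> ser" and A
    by (induction A rule: infinite_finite_induct) (simp_all add: T0 add)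
  have "T (trunc (N + m) f) = 0"
    by (simp add: trunc_def sum mon)
  moreover have "T f = T (f - trunc (N + m) f) + T (trunc (N + m) f)"
    by (simp flip: add)
  ultimately show "ord_ge N (T f)"
    using cont [OF ord_ge_trunc] by simp
qed

section \<open>Partial derivatives\<close>

lemma cf_pderiv:
  "cf (pderiv Cx f) i j k = of_nat (Suc i) * cf f (Suc i) j k"
  "cf (pderiv Cy1 f) i j k = of_nat (Suc j) * cf f i (Suc j) k"
  "cf (pderiv Cy2 f) i j k = of_nat (Suc k) * cf f i j (Suc k)"
  by (simp_all add: cf_def pderiv.simps fps_of_nat [symmetric] fps_mult_left_const_nth
        fps_const_add [symmetric] algebra_simps del: fps_const_add of_nat_Suc of_nat_add)

lemma pderiv_add: "pderiv c (f + g) = pderiv c f + pderiv c g"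
  and pderiv_diff: "pderiv c (f - g) = pderiv c f - pderiv c g"
  and pderiv_minus: "pderiv c (- f) = - pderiv c f"
  and pderiv_0 [simp]: "pderiv c 0 = 0"
  by (cases c; rule ser_eqI; simp add: cf_pderiv ring_distribs mult.left_commute)+

lemma pderiv_mult: "pderiv c (f * g) = pderiv c f * g + f * pderiv c g"
proof (cases c)
  case Cx
  then show ?thesis by (simp add: pderiv.simps)
next
  case Cy1
  show ?thesis unfolding Cy1
    by (rule fps_ext) (simp add: pderiv.simps fps_mult_nth fps_deriv_sum sum.distrib add.commute)
next
  case Cy2
  show ?thesis unfolding Cy2
    by (rule fps_ext, rule fps_ext)
      (simp add: pderiv.simps fps_mult_nth fps_sum_nth fps_deriv_sum sum.distrib add.commute)
qed

lemma pderiv_const [simp]: "pderiv c (const a) = 0" and pderiv_1 [simp]: "pderiv c 1 = 0"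
proof -
  show *: "pderiv c (const a) = 0" for a
    by (cases c; rule ser_eqI; simp add: cf_pderiv cf_const)
  show "pderiv c 1 = 0" using * [of 1] by simp
qed

lemma pderiv_var: "pderiv c (var d) = (if c = d then 1 else 0)"
  by (cases c; cases d; simp; intro ser_eqI; simp add: cf_pderiv cf_var cf_1)

lemma pderiv_commute: "pderiv c (pderiv d f) = pderiv d (pderiv c f)"
  by (cases c; cases d; simp; intro ser_eqI; simp add: cf_pderiv)

lemma ord_ge_pderiv: "ord_ge (Suc N) f \<Longrightarrow> ord_ge N (pderiv c f)"
  by (cases c) (auto simp: ord_ge_def cf_pderiv)

lemma ord_ge_pderiv': "ord_ge N f \<Longrightarrow> ord_ge (N - 1) (pderiv c f)"
  by (cases N) (auto intro: ord_ge_pderiv)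

section \<open>Substitution\<close>

definition subst_monom :: "(coord \<Rightarrow> ser) \<Rightarrow> nat \<Rightarrow> nat \<Rightarrow> nat \<Rightarrow> ser" where
  "subst_monom g a b d = g Cx ^ a * g Cy1 ^ b * g Cy2 ^ d"

lemma cf_subst: "cf (subst f g) i j k =
    (\<Sum>a\<le>i+j+k. \<Sum>b\<le>i+j+k. \<Sum>d\<le>i+j+k. cf f a b d * cf (subst_monom g a b d) i j k)"
  by (simp add: cf_def subst_def subst_monom_def)

lemma ord_ge_subst_monom: "singular g \<Longrightarrow> ord_ge (a + b + d) (subst_monom g a b d)"
  unfolding subst_monom_def singular_def by (intro ord_ge_mult ord_ge_power) auto

lemma subst_add: "subst (f + h) g = subst f g + subst h g"
  and subst_diff: "subst (f - h) g = subst f g - subst h g"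
  and subst_minus: "subst (- f) g = - subst f g"
  and subst_0 [simp]: "subst 0 g = 0"
  by (rule ser_eqI; simp add: cf_subst sum.distrib sum_subtractf sum_negf ring_distribs)+

lemma ord_ge_subst:
  assumes "singular g" "ord_ge N f"
  shows "ord_ge N (subst f g)"
  unfolding ord_ge_def cf_subst
proof (intro allI impI sum.neutral ballI)
  fix i j k a b d
  assume "i + j + k < N"
  show "cf f a b d * cf (subst_monom g a b d) i j k = 0"
  proof (cases "a + b + d < N")
    case True
    with assms show ?thesis by (auto simp: ord_ge_def)
  next
    case False
    with \<open>i + j + k < N\<close> ord_ge_subst_monom [OF assms(1), of a b d] show ?thesis
      by (auto simp: ord_ge_def)
  qed
qed

lemma subst_const_mult_monom:
  assumes "singular g"
  shows "subst (const c * monom I J K) g = const c * subst_monom g I J K"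
proof (rule ser_eqI)
  fix i j k :: nat
  let ?n = "i + j + k"
  have *: "cf (const c * monom I J K) a b d * X =
      (if d = K then if b = J then if a = I then c * X else 0 else 0 else 0)" for a b d X
    by (simp add: cf_monom)
  have "cf (subst (const c * monom I J K) g) i j k =
      (if I \<le> ?n \<and> J \<le> ?n \<and> K \<le> ?n then c * cf (subst_monom g I J K) i j k else 0)"
  proof (cases "I \<le> ?n \<and> J \<le> ?n \<and> K \<le> ?n")
    case True
    then show ?thesis unfolding cf_subst * by simp
  next
    case False
    then show ?thesis unfolding cf_subst * by (auto intro!: sum.neutral)
  qed
  \<comment> \<open>If the exponents leave the box of the sum, then \<open>I + J + K\<close> exceeds
    the degree, and the order of \<open>subst_monom\<close> makes this coefficient zero
    anyway.\<close>
  also have "\<dots> = c * cf (subst_monom g I J K) i j k"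
    using ord_ge_subst_monom [OF assms, of I J K] by (auto simp: ord_ge_def)
  finally show "cf (subst (const c * monom I J K) g) i j k =
      cf (const c * subst_monom g I J K) i j k" by simp
qed

lemma subst_const [simp]: "singular g \<Longrightarrow> subst (const c) g = const c"
  using subst_const_mult_monom [of g c 0 0 0] by (simp add: subst_monom_def)

lemma subst_1 [simp]: "singular g \<Longrightarrow> subst 1 g = 1"
  using subst_const [of g 1] by simp

lemma subst_var [simp]: "singular g \<Longrightarrow> subst (var c) g = g c"
  using subst_const_mult_monom [of g 1 "if c = Cx then 1 else 0" "if c = Cy1 then 1 else 0"
      "if c = Cy2 then 1 else 0"]
  by (cases c) (auto simp: subst_monom_def monom_def)

text \<open>Both sides are additive in each factor and respect the filtration, so density applies
  twice: first in \<open>f\<close> with a monomial as second factor, then in \<open>h\<close> with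
  \<open>f\<close> arbitrary.\<close>

lemma subst_mult:
  assumes g: "singular g"
  shows "subst (f * h) g = subst f g * subst h g"
proof -
  have mon: "subst (f * (const c * monom I J K)) g = subst f g * subst (const c * monom I J K) g"
    for c f I J K
  proof -
    have "subst (f * (const c * monom I J K)) g - subst f g * subst (const c * monom I J K) g = 0"
    proof (rule density [where m = 0 and T = "\<lambda>f. subst (f * (const c * monom I J K)) g
          - subst f g * subst (const c * monom I J K) g" and f = f])
      fix a i j k
      have "const a * monom i j k * (const c * monom I J K) =
          const (a * c) * monom (i + I) (j + J) (k + K)"
        by (simp only: const_mult monom_mult [symmetric] mult_ac)
      then show "subst (const a * monom i j k * (const c * monom I J K)) g
          - subst (const a * monom i j k) g * subst (const c * monom I J K) g = 0"
        by (simp only: subst_const_mult_monom [OF g])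
          (simp add: const_mult subst_monom_def power_add)
    next
      fix N f assume f: "ord_ge (N + 0) f"
      then have "ord_ge (N + 0) (f * (const c * monom I J K))"
        by (intro ord_ge_mult) auto
      moreover have "ord_ge (N + 0) (subst f g * subst (const c * monom I J K) g)"
        using f ord_ge_subst [OF g] by (intro ord_ge_mult) auto
      ultimately show "ord_ge N (subst (f * (const c * monom I J K)) g
          - subst f g * subst (const c * monom I J K) g)"
        using ord_ge_subst [OF g] by (auto intro: ord_ge_diff)
    qed (simp add: subst_add ring_distribs)
    then show ?thesis by simp
  qed
  have "subst (f * h) g - subst f g * subst h g = 0"
  proof (rule density [where m = 0 and T = "\<lambda>h. subst (f * h) g - subst f g * subst h g" and f = h])
    fix N h assume h: "ord_ge (N + 0) h"
    show "ord_ge N (subst (f * h) g - subst f g * subst h g)"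
      using h by (intro ord_ge_diff ord_ge_subst ord_ge_mult_left g) auto
  qed (simp_all add: mon subst_add ring_distribs)
  then show ?thesis by simp
qed

lemma subst_power: "singular g \<Longrightarrow> subst (f ^ n) g = subst f g ^ n"
  by (induction n) (simp_all add: subst_mult)

lemma singular_dcomp: "singular g \<Longrightarrow> singular h \<Longrightarrow> singular (dcomp g h)"
  unfolding singular_def dcomp_def ord_ge_1 [symmetric]
  by (simp add: ord_ge_subst singular_def ord_ge_1 [symmetric])

lemma singular_var [simp]: "singular var"
  by (simp add: singular_def)

lemma subst_subst:
  assumes g: "singular g" and h: "singular h"
  shows "subst (subst f g) h = subst f (dcomp g h)"
proof -
  note gh = singular_dcomp [OF g h]
  have "subst (subst f g) h - subst f (dcomp g h) = 0"
  proof (rule density [where m = 0 and T = "\<lambda>f. subst (subst f g) h - subst f (dcomp g h)"])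
    fix N f assume "ord_ge (N + 0) f"
    then show "ord_ge N (subst (subst f g) h - subst f (dcomp g h))"
      by (intro ord_ge_diff ord_ge_subst g h gh) auto
  next
    fix a i j k
    show "subst (subst (const a * monom i j k) g) h - subst (const a * monom i j k) (dcomp g h) = 0"
      by (simp only: subst_const_mult_monom [OF g] subst_const_mult_monom [OF gh])
        (simp add: subst_monom_def subst_mult subst_power h dcomp_def)
  qed (simp add: subst_add)
  then show ?thesis by simp
qed

lemma subst_var_id [simp]: "subst f var = f"
proof -
  have "subst f var - f = 0"
  proof (rule density [where m = 0 and T = "\<lambda>f. subst f var - f"])
    fix N f assume "ord_ge (N + 0) f"
    then show "ord_ge N (subst f var - f)"
      by (intro ord_ge_diff ord_ge_subst) auto
  next
    fix a i j k
    show "subst (const a * monom i j k) var - const a * monom i j k = 0"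
      by (simp only: subst_const_mult_monom [OF singular_var])
        (simp add: subst_monom_def monom_def)
  qed (simp add: subst_add)
  then show ?thesis by simp
qed

text \<open>The series satisfying the chain rule contain constants and variables and are closed
  under products, hence include all monomials. Density gives the rest, with \<open>m = 1\<close>
  because a derivative costs one order.\<close>

lemma pderiv_subst:
  assumes g: "singular g"
  shows "pderiv c (subst f g) = (\<Sum>d\<in>{Cx, Cy1, Cy2}. subst (pderiv d f) g * pderiv c (g d))"
proof -
  let ?R = "\<lambda>f. \<Sum>d\<in>{Cx, Cy1, Cy2}. subst (pderiv d f) g * pderiv c (g d)"
  define P where "P f \<longleftrightarrow> pderiv c (subst f g) = ?R f" for f
  have P_mult: "P (u * w)" if "P u" "P w" for u w
    using that g by (simp add: P_def pderiv_mult subst_mult subst_add algebra_simps)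
  have P_const: "P (const a)" for a
    using g by (simp add: P_def)
  have P_var: "P (var d)" for d
    using g by (cases d) (simp_all add: P_def pderiv_var)
  have P_power: "P (u ^ n)" if "P u" for u n
    using that P_const [of 1] by (induction n) (auto intro: P_mult)
  have "pderiv c (subst f g) - ?R f = 0"
  proof (rule density [where m = 1 and T = "\<lambda>f. pderiv c (subst f g) - ?R f"])
    fix N f assume "ord_ge (N + 1) f"
    then have f: "ord_ge (Suc N) f" by simp
    have "ord_ge (N + 0) (subst (pderiv d f) g * pderiv c (g d))" for d
      by (rule ord_ge_mult) (simp_all add: ord_ge_subst g ord_ge_pderiv f)
    then show "ord_ge N (pderiv c (subst f g) - ?R f)"
      using f by (intro ord_ge_diff ord_ge_subst ord_ge_pderiv ord_ge_sum g) auto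
  next
    fix a i j k
    have "P (const a * monom i j k)"
      by (simp add: monom_def P_mult P_const P_power P_var)
    then show "pderiv c (subst (const a * monom i j k) g) - ?R (const a * monom i j k) = 0"
      by (simp add: P_def)
  qed (simp add: subst_add pderiv_add ring_distribs)
  then show ?thesis by simp
qed

section \<open>Contraction principle in the topology of the order filtration\<close>

lemma ord_ge_mult_diff:
  assumes "ord_ge p f'" "ord_ge q g" "ord_ge (m + p) (f - f')" "ord_ge (m + q) (g - g')"
  shows "ord_ge (m + (p + q)) (f * g - f' * (g' :: ser))"
proof -
  have "f * g - f' * g' = (f - f') * g + f' * (g - g')"
    by (simp add: algebra_simps)
  moreover have "ord_ge ((m + p) + q) ((f - f') * g)" "ord_ge (p + (m + q)) (f' * (g - g'))"
    using assms by (auto intro: ord_ge_mult)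
  ultimately show ?thesis
    by (simp add: ord_ge_add add_ac)
qed

lemma ord_ge_power_diff:
  assumes "f \<in> mideal" "f' \<in> mideal" "ord_ge (Suc m) (f - f')"
  shows "ord_ge (m + n) (f ^ n - f' ^ n)"
proof (induction n)
  case (Suc n)
  have "ord_ge (m + (1 + n)) (f * f ^ n - f' * f' ^ n)"
    using assms by (intro ord_ge_mult_diff Suc ord_ge_power) (auto simp: ord_ge_1)
  then show ?case by simp
qed simp

text \<open>In a monomial of degree n, replace \<open>g\<close> by \<open>h\<close> one factor at a
  time: a factor of order 1 becomes a difference of order \<open>Suc m\<close>. The net gain
  \<open>m\<close> does not depend on n.\<close>

lemma ord_ge_subst_diff:
  assumes g: "singular g" and h: "singular h" and gh: "\<And>c. ord_ge (Suc m) (g c - h c)"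
    and f: "ord_ge r f"
  shows "ord_ge (m + r) (subst f g - subst f h)"
proof -
  have mon: "ord_ge (m + (a + b + d)) (subst_monom g a b d - subst_monom h a b d)" for a b d
    unfolding subst_monom_def
    using g h by (intro ord_ge_mult_diff ord_ge_power_diff ord_ge_mult ord_ge_power gh)
      (auto simp: singular_def)
  have eq: "cf (subst f g - subst f h) i j k = (\<Sum>a\<le>i+j+k. \<Sum>b\<le>i+j+k. \<Sum>d\<le>i+j+k.
      cf f a b d * cf (subst_monom g a b d - subst_monom h a b d) i j k)" for i j k
    by (simp add: cf_subst sum_subtractf right_diff_distrib)
  show ?thesis
    unfolding ord_ge_def eq
  proof (intro allI impI sum.neutral ballI)
    fix i j k a b d
    assume "i + j + k < m + r"
    then show "cf f a b d * cf (subst_monom g a b d - subst_monom h a b d) i j k = 0"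
      using f mon [of a b d] unfolding ord_ge_def
      by (cases "a + b + d < r") (auto simp del: cf_diff)
  qed
qed

text \<open>Banach's fixed point theorem for families of series of order at least 2. The index type
  lets several unknown series be solved for at once.\<close>

lemma contraction_fixpoint:
  fixes T :: "('i \<Rightarrow> ser) \<Rightarrow> 'i \<Rightarrow> ser"
  assumes inv: "\<And>u i. (\<And>i. ord_ge 2 (u i)) \<Longrightarrow> ord_ge 2 (T u i)"
    and contr: "\<And>u w m i. (\<And>i. ord_ge 2 (u i)) \<Longrightarrow> (\<And>i. ord_ge 2 (w i)) \<Longrightarrow>
      (\<And>i. ord_ge m (u i - w i)) \<Longrightarrow> m \<ge> 2 \<Longrightarrow> ord_ge (Suc m) (T u i - T w i)"
  obtains u where "\<And>i. ord_ge 2 (u i)" "T u = u"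
proof -
  define s where "s n = (T ^^ n) (\<lambda>i. 0)" for n
  have s_Suc: "s (Suc n) = T (s n)" for n
    by (simp add: s_def)
  have s2: "ord_ge 2 (s n i)" for n i
    by (induction n arbitrary: i) (simp add: s_def, simp add: s_Suc inv)
  have step: "ord_ge (n + 2) (s (Suc n) i - s n i)" for n i
  proof (induction n arbitrary: i)
    case 0
    show ?case using ord_ge_diff [OF s2 [of "Suc 0" i] s2 [of 0 i]] by (simp add: numeral_2_eq_2)
  next
    case (Suc n)
    have "ord_ge (Suc (n + 2)) (T (s (Suc n)) i - T (s n) i)"
      using Suc by (intro contr s2) auto
    then show ?case by (simp add: s_Suc)
  qed
  have cauchy: "ord_ge (n + 2) (s (n + l) i - s n i)" for n l i
  proof (induction l)
    case (Suc l)
    have "ord_ge (n + 2) (s (Suc (n + l)) i - s (n + l) i)"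
      by (rule ord_ge_mono [OF step]) simp
    from ord_ge_add [OF this Suc] show ?case by simp
  qed simp
  \<comment> \<open>The limit is read off diagonally: by \<open>cauchy\<close>, a coefficient of
    degree n no longer changes after the n-th iterate.\<close>
  define u where "u i = ser_of (\<lambda>a b d. cf (s (a + b + d) i) a b d)" for i
  have close: "ord_ge (n + 2) (u i - s n i)" for n i
    unfolding ord_ge_def
  proof (intro allI impI)
    fix a b d assume lt: "a + b + d < n + 2"
    show "cf (u i - s n i) a b d = 0"
    proof (cases "a + b + d \<le> n")
      case True
      then obtain l where "n = a + b + d + l" using le_Suc_ex by blast
      with cauchy [of "a + b + d" l i] show ?thesis
        by (auto simp: u_def ord_ge_def)
    next
      case False
      \<comment> \<open>In degree \<open>Suc n\<close> the limit is taken from the next iterate,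
        which by \<open>step\<close> agrees with \<open>s n\<close> below degree
        \<open>n + 2\<close>.\<close>
      with lt have "a + b + d = Suc n" by simp
      with step [of n i] lt show ?thesis
        by (auto simp: u_def ord_ge_def)
    qed
  qed
  have u2: "ord_ge 2 (u i)" for i
    using ord_ge_add [of 2, OF _ s2] close [of 0 i] by (metis add_0 diff_add_cancel)
  have "T u i - u i = 0" for i
  proof (rule ord_ge_all_0)
    fix N
    have "ord_ge (Suc (N + 2)) (T u i - T (s N) i)"
      by (intro contr u2 s2 close) auto
    moreover have "ord_ge (Suc (N + 2)) (u i - s (Suc N) i)"
      using close [of "Suc N" i] by simp
    ultimately have "ord_ge (Suc (N + 2)) ((T u i - T (s N) i) - (u i - s (Suc N) i))"
      by (rule ord_ge_diff)
    then show "ord_ge N (T u i - u i)"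
      using ord_ge_mono [of "Suc (N + 2)" _ N] by (simp add: s_Suc)
  qed
  then have "T u = u" by (intro ext) simp
  with u2 show ?thesis using that by blast
qed

section \<open>Formal diffeomorphisms\<close>

lemma dcomp_var [simp]: "dcomp \<Phi> var = \<Phi>"
  by (simp add: dcomp_def)

lemma var_dcomp [simp]: "singular \<Phi> \<Longrightarrow> dcomp var \<Phi> = \<Phi>"
  by (simp add: dcomp_def)

lemma dcomp_assoc: "singular \<Psi> \<Longrightarrow> singular \<Theta> \<Longrightarrow> dcomp (dcomp \<Phi> \<Psi>) \<Theta> = dcomp \<Phi> (dcomp \<Psi> \<Theta>)"
  by (simp add: dcomp_def subst_subst)

lemma Diff_singular: "\<Phi> \<in> Diff \<Longrightarrow> singular \<Phi>"
  by (simp add: Diff_def singular_def)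

lemma dinverse_unique:
  assumes "singular \<Phi>" "dinverse \<Phi> \<Psi>" "dinverse \<Phi> \<Psi>'"
  shows "\<Psi> = \<Psi>'"
proof -
  have s: "singular \<Psi>" "singular \<Psi>'"
    using assms by (auto simp: dinverse_def singular_def)
  have "dcomp (dcomp \<Psi> \<Phi>) \<Psi>' = dcomp \<Psi> (dcomp \<Phi> \<Psi>')"
    using s assms by (intro dcomp_assoc)
  with assms s show ?thesis by (simp add: dinverse_def)
qed

lemma dinverse_dinv:
  assumes "\<Phi> \<in> Diff" shows "dinverse \<Phi> (dinv \<Phi>)"
proof -
  have "\<exists>!\<Psi>. dinverse \<Phi> \<Psi>"
    using assms dinverse_unique [OF Diff_singular [OF assms]] by (auto simp: Diff_def)
  then show ?thesis
    unfolding dinv_def by (rule theI')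
qed

lemma
  assumes "\<Phi> \<in> Diff"
  shows singular_dinv: "singular (dinv \<Phi>)"
    and dcomp_dinv: "dcomp \<Phi> (dinv \<Phi>) = var"
    and dinv_dcomp: "dcomp (dinv \<Phi>) \<Phi> = var"
  using dinverse_dinv [OF assms] by (auto simp: dinverse_def singular_def)

lemma dinv_Diff:
  assumes "\<Phi> \<in> Diff" shows "dinv \<Phi> \<in> Diff"
  using singular_dinv [OF assms] dcomp_dinv [OF assms] dinv_dcomp [OF assms] Diff_singular [OF assms]
  unfolding Diff_def dinverse_def singular_def by blast

lemma DiffI:
  assumes "singular \<Phi>" "singular \<Psi>" "dcomp \<Phi> \<Psi> = var" "dcomp \<Psi> \<Phi> = var"
  shows "\<Phi> \<in> Diff"
  using assms unfolding Diff_def dinverse_def singular_def by blast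

lemma dcomp_Diff:
  assumes \<Phi>: "\<Phi> \<in> Diff" and \<Psi>: "\<Psi> \<in> Diff"
  shows "dcomp \<Phi> \<Psi> \<in> Diff"
proof (rule DiffI)
  note s = Diff_singular [OF \<Phi>] Diff_singular [OF \<Psi>] singular_dinv [OF \<Phi>] singular_dinv [OF \<Psi>]
  show "singular (dcomp \<Phi> \<Psi>)" "singular (dcomp (dinv \<Psi>) (dinv \<Phi>))"
    by (simp_all add: s singular_dcomp)
  have "dcomp (dcomp \<Phi> \<Psi>) (dcomp (dinv \<Psi>) (dinv \<Phi>)) =
      dcomp \<Phi> (dcomp (dcomp \<Psi> (dinv \<Psi>)) (dinv \<Phi>))"
    by (simp add: dcomp_assoc s singular_dcomp)
  then show "dcomp (dcomp \<Phi> \<Psi>) (dcomp (dinv \<Psi>) (dinv \<Phi>)) = var"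
    by (simp add: dcomp_dinv \<Phi> \<Psi> s)
  have "dcomp (dcomp (dinv \<Psi>) (dinv \<Phi>)) (dcomp \<Phi> \<Psi>) =
      dcomp (dinv \<Psi>) (dcomp (dcomp (dinv \<Phi>) \<Phi>) \<Psi>)"
    by (simp add: dcomp_assoc s singular_dcomp)
  then show "dcomp (dcomp (dinv \<Psi>) (dinv \<Phi>)) (dcomp \<Phi> \<Psi>) = var"
    by (simp add: dinv_dcomp \<Phi> \<Psi> s)
qed

text \<open>Tangency to the identity at the origin.\<close>

definition near_id :: "(coord \<Rightarrow> ser) \<Rightarrow> bool" where
  "near_id \<Phi> \<longleftrightarrow> (\<forall>c. ord_ge 2 (\<Phi> c - var c))"

lemma near_id_singular: "near_id \<Phi> \<Longrightarrow> singular \<Phi>"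
  unfolding near_id_def singular_def ord_ge_1 [symmetric]
  by (metis ord_ge_add diff_add_cancel ord_ge_var ord_ge_mono one_le_numeral One_nat_def)

lemma ord_ge_subst_near_id:
  assumes "near_id \<Phi>" "ord_ge r f" shows "ord_ge (Suc r) (subst f \<Phi> - f)"
  using ord_ge_subst_diff [OF near_id_singular [OF assms(1)] singular_var _ assms(2), of 1] assms(1)
  by (simp add: near_id_def numeral_2_eq_2)

text \<open>The map \<open>var + u\<close> is a left inverse exactly when \<open>u\<close> is a
  fixed point of \<open>?T\<close>. Since \<Phi> is tangent to the identity,
  \<open>subst f \<Phi> - f\<close> has higher order than \<open>f\<close>, so \<open>?T\<close> is
  a contraction.\<close>

lemma near_id_left_inverse:
  assumes \<Phi>: "near_id \<Phi>"
  obtains \<Psi> where "near_id \<Psi>" "dcomp \<Psi> \<Phi> = var"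
proof -
  note s = near_id_singular [OF \<Phi>]
  let ?T = "\<lambda>u c. (var c - \<Phi> c) - (subst (u c) \<Phi> - u c)"
  obtain u where u: "\<And>i. ord_ge 2 (u i)" "?T u = u"
  proof (rule contraction_fixpoint [of ?T])
    fix u :: "coord \<Rightarrow> ser" and i assume u: "\<And>i. ord_ge 2 (u i)"
    have "ord_ge 2 (var i - \<Phi> i)"
      using ord_ge_minus [of 2 "\<Phi> i - var i"] \<Phi> by (simp add: near_id_def)
    then show "ord_ge 2 ((var i - \<Phi> i) - (subst (u i) \<Phi> - u i))"
      by (rule ord_ge_diff) (intro ord_ge_diff ord_ge_subst s u)
  next
    fix u w :: "coord \<Rightarrow> ser" and m :: nat and i assume "\<And>i. ord_ge m (u i - w i)"
    from ord_ge_subst_near_id [OF \<Phi> this [of i]]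
    have "ord_ge (Suc m) (- (subst (u i - w i) \<Phi> - (u i - w i)))"
      by (intro ord_ge_minus)
    moreover have "- (subst (u i - w i) \<Phi> - (u i - w i)) =
        ((var i - \<Phi> i) - (subst (u i) \<Phi> - u i)) - ((var i - \<Phi> i) - (subst (w i) \<Phi> - w i))"
      by (simp only: subst_diff) (simp add: algebra_simps)
    ultimately show "ord_ge (Suc m) (((var i - \<Phi> i) - (subst (u i) \<Phi> - u i))
        - ((var i - \<Phi> i) - (subst (w i) \<Phi> - w i)))"
      by metis
  qed blast
  have "subst (var c + u c) \<Phi> = var c" for c
  proof -
    have "(var c - \<Phi> c) - (subst (u c) \<Phi> - u c) = u c"
      using fun_cong [OF u(2), of c] .
    then have "subst (u c) \<Phi> = var c - \<Phi> c"
      by (simp add: algebra_simps)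
    then show ?thesis
      by (simp add: subst_add s)
  qed
  then have "dcomp (\<lambda>c. var c + u c) \<Phi> = var"
    by (simp add: dcomp_def)
  moreover have "near_id (\<lambda>c. var c + u c)"
    by (simp add: near_id_def u(1))
  ultimately show ?thesis using that by blast
qed

text \<open>A left inverse \<Psi> of \<Phi> has itself a left inverse \<Theta>. Associativity gives
  \<Theta> = \<Phi>, so \<Psi> is a two-sided inverse.\<close>

lemma near_id_Diff:
  assumes "near_id \<Phi>" shows "\<Phi> \<in> Diff"
proof -
  obtain \<Psi> where \<Psi>: "near_id \<Psi>" "dcomp \<Psi> \<Phi> = var"
    using near_id_left_inverse [OF assms] .
  obtain \<Theta> where \<Theta>: "near_id \<Theta>" "dcomp \<Theta> \<Psi> = var"
    using near_id_left_inverse [OF \<Psi>(1)] .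
  note s = near_id_singular [OF assms] near_id_singular [OF \<Psi>(1)] near_id_singular [OF \<Theta>(1)]
  have "dcomp (dcomp \<Theta> \<Psi>) \<Phi> = dcomp \<Theta> (dcomp \<Psi> \<Phi>)"
    using s by (intro dcomp_assoc)
  then have "\<Phi> = \<Theta>" using \<Psi> \<Theta> s by simp
  with s \<Psi> \<Theta> show ?thesis by (intro DiffI [of _ \<Psi>]) auto
qed

section \<open>Vector fields, divergence and Jacobian\<close>

lemma along_eq: "along Y f = Y Cx * pderiv Cx f + Y Cy1 * pderiv Cy1 f + Y Cy2 * pderiv Cy2 f"
  by (simp add: along_def add.assoc)

lemma pderiv_subst_eq:
  "singular g \<Longrightarrow> pderiv c (subst f g) = subst (pderiv Cx f) g * pderiv c (g Cx)
     + subst (pderiv Cy1 f) g * pderiv c (g Cy1) + subst (pderiv Cy2 f) g * pderiv c (g Cy2)"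
  by (simp add: pderiv_subst add.assoc)

lemma along_var [simp]: "along Y (var c) = Y c"
  by (cases c) (simp_all add: along_eq pderiv_var)

lemma along_add: "along Y (f + g) = along Y f + along Y g"
  and along_diff: "along Y (f - g) = along Y f - along Y g"
  and along_minus: "along Y (- f) = - along Y f"
  and along_0 [simp]: "along Y 0 = 0"
  and along_1 [simp]: "along Y 1 = 0"
  and along_const [simp]: "along Y (const a) = 0"
  and along_mult: "along Y (f * g) = along Y f * g + f * along Y g"
  by (simp_all add: along_eq pderiv_add pderiv_diff pderiv_minus pderiv_mult algebra_simps)

lemma along_power2: "along Y (f ^ 2) = 2 * f * along Y f"
  by (simp add: power2_eq_square along_mult algebra_simps)

text \<open>Forms are compared modulo dx, so only the directions y1 and y2 count. Modulo dx,
  \<open>divy\<close> and \<open>jac\<close> are the factors that the Lie derivative and the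
  pullback produce on the area form dy1 \<and> dy2.\<close>

definition divy :: "(coord \<Rightarrow> ser) \<Rightarrow> ser" where
  "divy Y = pderiv Cy1 (Y Cy1) + pderiv Cy2 (Y Cy2)"

definition jac :: "(coord \<Rightarrow> ser) \<Rightarrow> ser" where
  "jac \<Phi> = pderiv Cy1 (\<Phi> Cy1) * pderiv Cy2 (\<Phi> Cy2) - pderiv Cy2 (\<Phi> Cy1) * pderiv Cy1 (\<Phi> Cy2)"

text \<open>Conjugacy written without the inverse of \<Phi>. On \<open>Diff\<close> it is equivalent
  to the equation for \<open>push\<close>, and it can be composed and differentiated
  directly.\<close>

definition intertwines :: "(coord \<Rightarrow> ser) \<Rightarrow> (coord \<Rightarrow> ser) \<Rightarrow> (coord \<Rightarrow> ser) \<Rightarrow> bool" where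
  "intertwines \<Phi> Y Z \<longleftrightarrow> (\<forall>c. along Y (\<Phi> c) = subst (Z c) \<Phi>)"

lemma intertwinesD: "intertwines \<Phi> Y Z \<Longrightarrow> along Y (\<Phi> c) = subst (Z c) \<Phi>"
  by (simp add: intertwines_def)

lemma push_eq_iff:
  assumes "\<Phi> \<in> Diff"
  shows "push \<Phi> Y = Z \<longleftrightarrow> intertwines \<Phi> Y Z"
proof
  assume "push \<Phi> Y = Z"
  then have "subst (Z c) \<Phi> = along Y (\<Phi> c)" for c
    using assms
    by (auto simp: push_def subst_subst Diff_singular singular_dinv dinv_dcomp)
  then show "intertwines \<Phi> Y Z" by (simp add: intertwines_def)
next
  assume "intertwines \<Phi> Y Z"
  then show "push \<Phi> Y = Z"
    using assms
    by (auto simp: push_def intertwines_def subst_subst Diff_singular singular_dinv dcomp_dinv)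
qed

lemma along_subst:
  assumes "singular \<Phi>" "intertwines \<Phi> Y Z"
  shows "along Y (subst f \<Phi>) = subst (along Z f) \<Phi>"
proof -
  have "along Y (subst f \<Phi>) = subst (pderiv Cx f) \<Phi> * along Y (\<Phi> Cx)
      + subst (pderiv Cy1 f) \<Phi> * along Y (\<Phi> Cy1) + subst (pderiv Cy2 f) \<Phi> * along Y (\<Phi> Cy2)"
    by (simp add: along_eq pderiv_subst_eq assms(1) algebra_simps)
  also have "\<dots> = subst (along Z f) \<Phi>"
    by (simp add: intertwinesD [OF assms(2)] along_eq [of Z] subst_add subst_mult assms(1) mult.commute)
  finally show ?thesis .
qed

lemma intertwines_dcomp:
  assumes "singular \<Phi>" "singular \<Psi>" "intertwines \<Phi> Y Z" "intertwines \<Psi> Z W"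
  shows "intertwines (dcomp \<Psi> \<Phi>) Y W"
  unfolding intertwines_def
proof
  fix c
  have "along Y (dcomp \<Psi> \<Phi> c) = subst (along Z (\<Psi> c)) \<Phi>"
    using assms by (simp add: dcomp_def along_subst)
  also have "\<dots> = subst (W c) (dcomp \<Psi> \<Phi>)"
    using assms by (simp add: intertwinesD subst_subst)
  finally show "along Y (dcomp \<Psi> \<Phi> c) = subst (W c) (dcomp \<Psi> \<Phi>)" .
qed

lemma intertwines_dinv:
  assumes \<Phi>: "\<Phi> \<in> Diff" and int: "intertwines \<Phi> Y Z"
  shows "intertwines (dinv \<Phi>) Z Y"
  unfolding intertwines_def
proof
  fix c
  note s = Diff_singular [OF \<Phi>] singular_dinv [OF \<Phi>]
  have "subst (along Z (dinv \<Phi> c)) \<Phi> = along Y (dcomp (dinv \<Phi>) \<Phi> c)"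
    by (simp add: dcomp_def along_subst [OF s(1) int])
  also have "\<dots> = Y c" by (simp add: dinv_dcomp [OF \<Phi>])
  finally have "subst (subst (along Z (dinv \<Phi> c)) \<Phi>) (dinv \<Phi>) = subst (Y c) (dinv \<Phi>)"
    by simp
  then show "along Z (dinv \<Phi> c) = subst (Y c) (dinv \<Phi>)"
    by (simp add: subst_subst s dcomp_dinv [OF \<Phi>])
qed

text \<open>A description of \<open>Diff_omega\<close> free of differential forms; the equivalence
  is \<open>Diff_omega_iff\<close>.\<close>

definition sympl :: "(coord \<Rightarrow> ser) \<Rightarrow> bool" where
  "sympl \<Phi> \<longleftrightarrow> \<Phi> \<in> Diff \<and> \<Phi> Cx = var Cx \<and> jac \<Phi> = 1"

lemma jac_dcomp:
  assumes "singular \<Phi>" "\<Phi> Cx = var Cx"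
  shows "jac (dcomp \<Psi> \<Phi>) = subst (jac \<Psi>) \<Phi> * jac \<Phi>"
  using assms
  by (simp add: jac_def dcomp_def pderiv_subst_eq pderiv_var subst_diff subst_mult algebra_simps)

lemma jac_var [simp]: "jac var = 1"
  by (simp add: jac_def pderiv_var)

lemma sympl_dcomp:
  assumes "sympl \<Phi>" "sympl \<Psi>" shows "sympl (dcomp \<Psi> \<Phi>)"
  using assms jac_dcomp [of \<Phi> \<Psi>]
  by (auto simp: sympl_def dcomp_Diff Diff_singular) (simp add: dcomp_def Diff_singular)

lemma dinv_Cx:
  assumes "\<Phi> \<in> Diff" "\<Phi> Cx = var Cx" shows "dinv \<Phi> Cx = var Cx"
  using fun_cong [OF dcomp_dinv [OF assms(1)], of Cx] assms
  by (simp add: dcomp_def singular_dinv)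

lemma sympl_dinv:
  assumes "sympl \<Phi>" shows "sympl (dinv \<Phi>)"
proof -
  have \<Phi>: "\<Phi> \<in> Diff" "\<Phi> Cx = var Cx" "jac \<Phi> = 1" using assms by (auto simp: sympl_def)
  have "jac (dcomp \<Phi> (dinv \<Phi>)) = subst (jac \<Phi>) (dinv \<Phi>) * jac (dinv \<Phi>)"
    using \<Phi> by (intro jac_dcomp singular_dinv dinv_Cx)
  then have "jac (dinv \<Phi>) = 1" using \<Phi> by (simp add: dcomp_dinv singular_dinv)
  with \<Phi> show ?thesis by (simp add: sympl_def dinv_Diff dinv_Cx)
qed

lemma pderiv_along:
  "pderiv c (along Y f) = along Y (pderiv c f) + pderiv c (Y Cx) * pderiv Cx f
     + pderiv c (Y Cy1) * pderiv Cy1 f + pderiv c (Y Cy2) * pderiv Cy2 f"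
  by (simp add: along_eq pderiv_add pderiv_mult pderiv_commute [of c] algebra_simps)

text \<open>Differentiating the conjugacy equation in y1 and y2 gives, for the Jacobian matrix J of
  \<Phi>, the identity Y(J) = (DZ o \<Phi>) J - J DY. Applying Y to the determinant turns both
  factors into traces.\<close>

lemma divy_intertwines:
  assumes \<Phi>: "singular \<Phi>" "\<Phi> Cx = var Cx" and int: "intertwines \<Phi> Y Z"
    and Yx: "pderiv Cy1 (Y Cx) = 0" "pderiv Cy2 (Y Cx) = 0"
  shows "subst (divy Z) \<Phi> * jac \<Phi> = along Y (jac \<Phi>) + divy Y * jac \<Phi>"
proof -
  let ?J = "\<lambda>c d. pderiv d (\<Phi> c)" and ?S = "\<lambda>c d. subst (pderiv d (Z c)) \<Phi>"
  have eq: "along Y (?J c d) = ?S c Cy1 * ?J Cy1 d + ?S c Cy2 * ?J Cy2 d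
      - pderiv d (Y Cy1) * ?J c Cy1 - pderiv d (Y Cy2) * ?J c Cy2" if "d \<noteq> Cx" for c d
  proof -
    have "pderiv d (along Y (\<Phi> c)) = ?S c Cy1 * ?J Cy1 d + ?S c Cy2 * ?J Cy2 d"
      using that \<Phi> by (simp add: intertwinesD [OF int] pderiv_subst_eq pderiv_var)
    moreover have "pderiv d (Y Cx) = 0" using that Yx by (cases d) auto
    ultimately show ?thesis by (simp add: pderiv_along algebra_simps)
  qed
  have "along Y (jac \<Phi>) = along Y (?J Cy1 Cy1) * ?J Cy2 Cy2 + ?J Cy1 Cy1 * along Y (?J Cy2 Cy2)
     - along Y (?J Cy1 Cy2) * ?J Cy2 Cy1 - ?J Cy1 Cy2 * along Y (?J Cy2 Cy1)"
    by (simp add: jac_def along_diff along_mult)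
  then show ?thesis
    by (simp add: eq) (simp add: divy_def jac_def subst_add \<Phi>(1) algebra_simps)
qed

section \<open>Transversal forms\<close>

lemma UNIV_coord: "UNIV = {Cx, Cy1, Cy2}"
proof -
  have "c \<in> {Cx, Cy1, Cy2}" for c by (cases c) auto
  then show ?thesis by blast
qed

instance coord :: finite
  by standard (simp add: UNIV_coord)

lemma Pow_Cy: "Pow {Cy1, Cy2} = {{}, {Cy1}, {Cy2}, {Cy1, Cy2}}"
  by (auto simp: Pow_insert)

lemma coord_set_not_Cx: "Cx \<notin> S \<Longrightarrow> S \<in> {{}, {Cy1}, {Cy2}, {Cy1, Cy2}}"
proof -
  assume "Cx \<notin> S"
  have "c \<in> {Cy1, Cy2}" if "c \<in> S" for c
    using that \<open>Cx \<notin> S\<close> by (cases c) auto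
  then have "S \<in> Pow {Cy1, Cy2}" by blast
  then show ?thesis by (simp only: Pow_Cy)
qed

lemma Compl_coord: "- {Cy1} = {Cx, Cy2}" "- {Cy2} = {Cx, Cy1}" "- {Cy1, Cy2} = {Cx}"
  "- {} = {Cx, Cy1, Cy2}" "- {Cx} = {Cy1, Cy2}"
  by (simp_all add: Compl_eq_Diff_UNIV UNIV_coord insert_Diff_if)

lemma wsign_square: "wsign S T * wsign S T = 1"
  by (simp add: wsign_def flip: power_mult_distrib)

lemma wsign_empty [simp]: "wsign S {} = 1" "wsign {} S = 1"
  by (simp_all add: wsign_def)

lemma wsign_Cy [simp]: "wsign {Cy1} {Cy2} = 1" "wsign {Cy2} {Cy1} = -1"
proof -
  have "{(c, d). c \<in> {Cy1} \<and> d \<in> {Cy2} \<and> crank d < crank c} = {}"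
    "{(c, d). c \<in> {Cy2} \<and> d \<in> {Cy1} \<and> crank d < crank c} = {(Cy2, Cy1)}"
    by auto
  then show "wsign {Cy1} {Cy2} = 1" "wsign {Cy2} {Cy1} = -1"
    by (simp_all only: wsign_def) simp_all
qed

lemma ext_d_form0: "ext_d (form0 f) S = (\<Sum>c\<in>UNIV. if S = {c} then pderiv c f else 0)"
proof -
  have "wsign {c} (S - {c}) * pderiv c (form0 f (S - {c})) = (if S = {c} then pderiv c f else 0)"
    if "c \<in> S" for c
    using that by (auto simp: form0_def)
  then have "ext_d (form0 f) S = (\<Sum>c\<in>S. if S = {c} then pderiv c f else 0)"
    by (simp add: ext_d_def)
  also have "\<dots> = (\<Sum>c\<in>UNIV. if S = {c} then pderiv c f else 0)"
    by (rule sum.mono_neutral_left) auto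
  finally show ?thesis .
qed

lemma ext_d_form0_simps:
  "ext_d (form0 f) {} = 0" "ext_d (form0 f) {Cy1} = pderiv Cy1 f" "ext_d (form0 f) {Cy2} = pderiv Cy2 f"
  "ext_d (form0 f) {Cy1, Cy2} = 0"
  by (auto simp: ext_d_form0 UNIV_coord)

lemma dvar_apply: "dvar c S = (if S = {c} then 1 else 0)"
proof -
  have "dvar c S = (\<Sum>d\<in>UNIV. if S = {d} then if d = c then 1 else 0 else 0)"
    by (auto simp: dvar_def ext_d_form0 pderiv_var intro!: sum.cong)
  also have "\<dots> = (\<Sum>d\<in>UNIV. if d = c then if S = {c} then 1 else 0 else 0)"
    by (intro sum.cong) auto
  finally show ?thesis by simp
qed

lemma wedge_dx: "wedge (dvar Cx) \<beta> S = (if Cx \<in> S then wsign {Cx} (S - {Cx}) * \<beta> (S - {Cx}) else 0)"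
proof -
  have "wedge (dvar Cx) \<beta> S =
      (\<Sum>T\<in>Pow S. if T = {Cx} then wsign {Cx} (S - {Cx}) * \<beta> (S - {Cx}) else 0)"
    unfolding wedge_def by (intro sum.cong) (auto simp: dvar_apply)
  then show ?thesis by simp
qed

lemma dx_ideal_iff: "\<alpha> \<in> dx_ideal \<longleftrightarrow> (\<forall>S. Cx \<notin> S \<longrightarrow> \<alpha> S = 0)"
proof
  assume "\<alpha> \<in> dx_ideal"
  then show "\<forall>S. Cx \<notin> S \<longrightarrow> \<alpha> S = 0"
    by (auto simp: dx_ideal_def wedge_dx)
next
  assume 0: "\<forall>S. Cx \<notin> S \<longrightarrow> \<alpha> S = 0"
  \<comment> \<open>The quotient strips dx from each component; the sign is its own inverse.\<close>
  have "\<alpha> = wedge (dvar Cx) (\<lambda>S. wsign {Cx} S * \<alpha> (insert Cx S))"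
  proof
    fix S
    show "\<alpha> S = wedge (dvar Cx) (\<lambda>S. wsign {Cx} S * \<alpha> (insert Cx S)) S"
      using 0 wsign_square [of "{Cx}" "S - {Cx}"]
      by (auto simp: wedge_dx insert_absorb simp flip: mult.assoc)
  qed
  then show "\<alpha> \<in> dx_ideal" by (auto simp: dx_ideal_def)
qed

lemma wedge_Cy:
  "wedge \<alpha> \<beta> {} = \<alpha> {} * \<beta> {}"
  "wedge \<alpha> \<beta> {Cy1} = \<alpha> {} * \<beta> {Cy1} + \<alpha> {Cy1} * \<beta> {}"
  "wedge \<alpha> \<beta> {Cy2} = \<alpha> {} * \<beta> {Cy2} + \<alpha> {Cy2} * \<beta> {}"
  "wedge \<alpha> \<beta> {Cy1, Cy2} = \<alpha> {} * \<beta> {Cy1, Cy2} + \<alpha> {Cy1} * \<beta> {Cy2} - \<alpha> {Cy2} * \<beta> {Cy1}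
     + \<alpha> {Cy1, Cy2} * \<beta> {}"
proof -
  have ne: "{Cy1} \<noteq> {Cy1, Cy2}" "{Cy2} \<noteq> {Cy1, Cy2}" and d: "{Cy1, Cy2} - {Cy1} = {Cy2}" "{Cy1, Cy2} - {Cy2} = {Cy1}"
    by auto
  show "wedge \<alpha> \<beta> {} = \<alpha> {} * \<beta> {}"
    by (simp add: wedge_def)
  show "wedge \<alpha> \<beta> {Cy1} = \<alpha> {} * \<beta> {Cy1} + \<alpha> {Cy1} * \<beta> {}"
    "wedge \<alpha> \<beta> {Cy2} = \<alpha> {} * \<beta> {Cy2} + \<alpha> {Cy2} * \<beta> {}"
    by (simp_all add: wedge_def Pow_insert)
  show "wedge \<alpha> \<beta> {Cy1, Cy2} = \<alpha> {} * \<beta> {Cy1, Cy2} + \<alpha> {Cy1} * \<beta> {Cy2} - \<alpha> {Cy2} * \<beta> {Cy1}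
     + \<alpha> {Cy1, Cy2} * \<beta> {}"
    by (simp add: wedge_def Pow_Cy ne d)
qed

lemma wedge_dy: "wedge (dvar Cy1) (dvar Cy2) S = (if S = {Cy1, Cy2} then 1 else 0)"
proof -
  have "wedge (dvar Cy1) (dvar Cy2) S =
      (\<Sum>T\<in>Pow S. if T = {Cy1} then wsign {Cy1} (S - {Cy1}) * dvar Cy2 (S - {Cy1}) else 0)"
    unfolding wedge_def by (intro sum.cong) (auto simp: dvar_apply)
  also have "\<dots> = (if Cy1 \<in> S then wsign {Cy1} (S - {Cy1}) * dvar Cy2 (S - {Cy1}) else 0)"
    by simp
  also have "\<dots> = (if S = {Cy1, Cy2} then 1 else 0)"
  proof (cases "Cy1 \<in> S \<and> S - {Cy1} = {Cy2}")
    case True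
    then have "S = {Cy1, Cy2}" by blast
    moreover have "{Cy1, Cy2} - {Cy1} = {Cy2}" by auto
    ultimately show ?thesis by (simp add: dvar_apply)
  next
    case False
    then have "S \<noteq> {Cy1, Cy2}" by auto
    with False show ?thesis by (auto simp: dvar_apply)
  qed
  finally show ?thesis .
qed

text \<open>Both dx and dy1 \<and> dy2 are closed, so only the exterior derivative of the
  contraction survives in the Lie derivative. Membership in the ideal is then read off on components
  without dx, and division by x contributes the term \<open>fps_shift 1 (Y Cx)\<close>.\<close>

lemma D_omegaD:
  assumes "Y \<in> D_omega"
  shows "pderiv Cy1 (Y Cx) = 0" "pderiv Cy2 (Y Cx) = 0" "divy Y = fps_shift 1 (Y Cx)"
proof -
  have 1: "lie Y (dvar Cx) S = 0" and 2: "x_times (lie_over_x Y omega) S = 0" if "Cx \<notin> S" for S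
    using assms that by (auto simp: D_omega_def dx_ideal_iff)
  have "ext_d (dvar Cx) S = 0" for S
    by (auto simp: ext_d_def dvar_apply intro!: sum.neutral)
  then have "contract Y (ext_d (dvar Cx)) S = 0" for S
    by (simp add: contract_def)
  moreover have "contract Y (dvar Cx) {} = Y Cx"
    by (simp add: contract_def dvar_apply mult_delta_right)
  ultimately have "lie Y (dvar Cx) {c} = pderiv c (Y Cx)" for c
    by (simp add: lie_def ext_d_def [of "contract Y (dvar Cx)"])
  with 1 show "pderiv Cy1 (Y Cx) = 0" "pderiv Cy2 (Y Cx) = 0"
    by (metis coord.distinct(1,3) singletonD)+
  have d: "{Cy1, Cy2} - {Cy1} = {Cy2}" "{Cy1, Cy2} - {Cy2} = {Cy1}" by auto
  have ne: "{Cx, Cy1} \<noteq> {Cy1, Cy2}" "{Cx, Cy2} \<noteq> {Cy1, Cy2}" by auto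
  have ins: "{Cy2, Cy1} = {Cy1, Cy2}" by auto
  let ?w = "wedge (dvar Cy1) (dvar Cy2)"
  have "ext_d ?w S = 0" for S
    by (auto simp: ext_d_def wedge_dy intro!: sum.neutral)
  then have "contract Y (ext_d ?w) S = 0" for S
    by (simp add: contract_def)
  moreover have "contract Y ?w {Cy1} = - Y Cy2" "contract Y ?w {Cy2} = Y Cy1"
    by (simp_all add: contract_def wedge_dy Compl_coord ne ins)
  ultimately have "lie Y ?w {Cy1, Cy2} = divy Y"
    by (simp add: lie_def ext_d_def [of "contract Y ?w"] d divy_def pderiv_minus)
  with 2 [of "{Cy1, Cy2}"] show "divy Y = fps_shift 1 (Y Cx)"
    by (simp add: omega_def smul_def wedge_dy)
qed

text \<open>Among the components without dx, the pullback of dy1 \<and> dy2 has only the one at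
  \<open>{Cy1, Cy2}\<close>, and it equals \<open>jac \<Phi>\<close>.\<close>

lemma Diff_omega_iff: "\<Phi> \<in> Diff_omega \<longleftrightarrow> sympl \<Phi>"
proof (cases "\<Phi> \<in> Diff")
  case True
  note s = Diff_singular [OF True]
  let ?w = "wedge (dvar Cy1) (dvar Cy2)"
  have sum_fun: "(\<Sum>S\<in>A. h S) T = (\<Sum>S\<in>A. h S T)" for h :: "coord set \<Rightarrow> form" and A T
    by (induction A rule: infinite_finite_induct) auto
  have "pullback \<Phi> (form0 f) = form0 (subst f \<Phi>)" for f
  proof
    fix S
    have "pullback \<Phi> (form0 f) S = (\<Sum>T\<in>Pow {Cx, Cy1, Cy2}. if T = {} then form0 (subst f \<Phi>) S else 0)"
      unfolding pullback_def sum_fun by (intro sum.cong) (auto simp: smul_def form0_def)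
    then show "pullback \<Phi> (form0 f) S = form0 (subst f \<Phi>) S" by simp
  qed
  moreover have "form0 f = form0 g \<longleftrightarrow> f = g" for f g
    by (auto simp: form0_def dest: fun_cong [where x = "{}"])
  ultimately have x: "pullback \<Phi> (form0 (var Cx)) = form0 (var Cx) \<longleftrightarrow> \<Phi> Cx = var Cx"
    using s by simp
  have pb: "pullback \<Phi> ?w = wedge (ext_d (form0 (\<Phi> Cy1))) (wedge (ext_d (form0 (\<Phi> Cy2))) (form0 1))"
    (is "_ = ?r")
  proof
    fix S
    have "pullback \<Phi> ?w S = (\<Sum>T\<in>Pow {Cx, Cy1, Cy2}. if T = {Cy1, Cy2} then ?r S else 0)"
      unfolding pullback_def sum_fun using s
      by (intro sum.cong) (auto simp: smul_def wedge_dy)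
    then show "pullback \<Phi> ?w S = ?r S" by simp
  qed
  have form0_1: "form0 1 {} = 1" "form0 1 {Cy1} = 0" "form0 1 {Cy2} = 0" "form0 1 {Cy1, Cy2} = 0"
    by (simp_all add: form0_def)
  have r: "?r {} = 0" "?r {Cy1} = 0" "?r {Cy2} = 0" "?r {Cy1, Cy2} = jac \<Phi>"
    by (simp_all add: wedge_Cy ext_d_form0_simps form0_1 jac_def)
  have "(\<exists>\<beta>\<in>dx_ideal. x_times (pullback_over_x \<Phi> omega) = x_times omega + \<beta>)
      \<longleftrightarrow> ?r - ?w \<in> dx_ideal"
    by (auto simp: omega_def pb intro!: bexI [of _ "?r - ?w"])
  also have "\<dots> \<longleftrightarrow> jac \<Phi> = 1"
  proof
    assume "?r - ?w \<in> dx_ideal"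
    then have "Cx \<notin> {Cy1, Cy2} \<longrightarrow> (?r - ?w) {Cy1, Cy2} = 0"
      unfolding dx_ideal_iff by (rule spec)
    then have "(?r - ?w) {Cy1, Cy2} = 0" by simp
    then show "jac \<Phi> = 1" by (simp add: r wedge_dy)
  next
    assume j: "jac \<Phi> = 1"
    have "(?r - ?w) S = 0" if "Cx \<notin> S" for S
    proof -
      have "S = {} \<or> S = {Cy1} \<or> S = {Cy2} \<or> S = {Cy1, Cy2}"
        using coord_set_not_Cx [OF that] by simp
      then show ?thesis
      proof (elim disjE)
        assume S: "S = {}" show ?thesis unfolding S by (simp add: r wedge_dy)
      next
        assume S: "S = {Cy1}" show ?thesis unfolding S by (simp add: r wedge_dy)
      next
        assume S: "S = {Cy2}" show ?thesis unfolding S by (simp add: r wedge_dy)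
      next
        assume S: "S = {Cy1, Cy2}" show ?thesis unfolding S by (simp add: r wedge_dy j)
      qed
    qed
    then show "?r - ?w \<in> dx_ideal" unfolding dx_ideal_iff by blast
  qed
  finally show ?thesis by (simp add: Diff_omega_def sympl_def True x)
qed (auto simp: Diff_omega_def sympl_def)

section \<open>The semisimple part and resonant vector fields\<close>

lemma vf_simps [simp]: "vf a b d Cx = a" "vf a b d Cy1 = b" "vf a b d Cy2 = d"
  by (simp_all add: vf_def)

fun wt :: "coord \<Rightarrow> complex" where
  "wt Cx = 0" | "wt Cy1 = -1" | "wt Cy2 = 1"

text \<open>The diagonal field E, with eigenvalues \<open>wt\<close>. Monomials are eigenvectors of
  its derivation, with eigenvalue the exponent of y2 minus that of y1.\<close>

definition Eul :: "coord \<Rightarrow> ser" where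
  "Eul c = const (wt c) * var c"

lemma along_Eul: "along Eul f = var Cy2 * pderiv Cy2 f - var Cy1 * pderiv Cy1 f"
  by (simp add: along_eq Eul_def const_minus)

lemma cf_Eul [simp]: "cf (along Eul f) i j k = (of_nat k - of_nat j) * cf f i j k"
  by (cases j; cases k) (simp_all add: along_Eul cf_var_mult cf_pderiv algebra_simps)

text \<open>For a vector field this means that it commutes with \<open>Eul\<close>. For a map the
  same equations say that it intertwines \<open>Eul\<close> with itself. Both readings are
  used.\<close>

definition resonant :: "(coord \<Rightarrow> ser) \<Rightarrow> bool" where
  "resonant Z \<longleftrightarrow> (\<forall>c. along Eul (Z c) = const (wt c) * Z c)"

lemma resonantD:
  assumes "resonant Z"
  shows "along Eul (Z Cx) = 0" "along Eul (Z Cy1) = - Z Cy1" "along Eul (Z Cy2) = Z Cy2"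
  using assms unfolding resonant_def
  by (metis wt.simps const_0 const_1 const_minus mult_1 mult_zero_left mult_minus_left)+

lemma along_Eul_commute:
  assumes "resonant Z"
  shows "along Eul (along Z f) = along Z (along Eul f)"
proof -
  note Z = resonantD [OF assms]
  have 1: "along Eul (along Z f) = - Z Cy1 * pderiv Cy1 f + Z Cy2 * pderiv Cy2 f
      + Z Cx * along Eul (pderiv Cx f) + Z Cy1 * along Eul (pderiv Cy1 f) + Z Cy2 * along Eul (pderiv Cy2 f)"
    by (simp add: along_eq [of Z] along_add along_mult Z)
  have 2: "along Z (along Eul f) = - Z Cy1 * pderiv Cy1 f + Z Cy2 * pderiv Cy2 f
      + var Cy2 * along Z (pderiv Cy2 f) - var Cy1 * along Z (pderiv Cy1 f)"
    by (simp add: along_Eul along_diff along_mult)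
  show ?thesis
    unfolding 1 2
    by (simp add: along_Eul along_eq [of Z] pderiv_commute [of Cy1 Cx] pderiv_commute [of Cy2 Cx]
        pderiv_commute [of Cy2 Cy1] algebra_simps)
qed

section \<open>Fields with linear part \<open>lam\<close> times \<open>Eul\<close>\<close>

definition perturbation :: "complex \<Rightarrow> (coord \<Rightarrow> ser) \<Rightarrow> bool" where
  "perturbation lam Z \<longleftrightarrow> (\<forall>c. ord_ge 2 (Z c - const (lam * wt c) * var c))"

lemma ord_ge_along_Eul: "ord_ge n f \<Longrightarrow> ord_ge n (along Eul f)"
  by (simp add: ord_ge_def)

lemma ord_ge_const_mult: "ord_ge n f \<Longrightarrow> ord_ge n (const a * f)"
  by (simp add: ord_ge_def)

text \<open>The coefficients of the difference of the two fields have order 2 and a derivative costs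
  one order, which leaves a gain of one.\<close>

lemma perturbation_along:
  assumes "perturbation lam Z" "ord_ge n f"
  shows "ord_ge (Suc n) (along Z f - const lam * along Eul f)"
proof -
  have "along Z f - const lam * along Eul f =
      (\<Sum>c\<in>{Cx, Cy1, Cy2}. (Z c - const (lam * wt c) * var c) * pderiv c f)"
    by (simp add: along_Eul along_eq [of Z] const_minus algebra_simps)
  moreover have "ord_ge (Suc n) ((Z c - const (lam * wt c) * var c) * pderiv c f)" for c
  proof -
    have "ord_ge (2 + (n - 1)) ((Z c - const (lam * wt c) * var c) * pderiv c f)"
      using assms by (intro ord_ge_mult ord_ge_pderiv') (simp_all add: perturbation_def)
    then show ?thesis by (rule ord_ge_mono) simp
  qed
  ultimately show ?thesis by (simp only: ord_ge_sum)
qed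

lemma perturbation_along_ord:
  assumes "perturbation lam Z" "ord_ge n f"
  shows "ord_ge n (along Z f)"
proof -
  have "ord_ge n (along Z f - const lam * along Eul f)"
    using perturbation_along [OF assms] by (rule ord_ge_mono) simp
  moreover have "ord_ge n (const lam * along Eul f)"
    using assms by (intro ord_ge_const_mult ord_ge_along_Eul)
  ultimately have "ord_ge n ((along Z f - const lam * along Eul f) + const lam * along Eul f)"
    by (rule ord_ge_add)
  then show ?thesis by simp
qed

text \<open>The lowest-order term of \<open>Q\<close> lies in the kernel of the semisimple operator \<open>E - m\<close>; since
  \<open>Q\<close> also lies in the image of that operator, the term vanishes.\<close>

lemma eigenvector_vanishes:
  assumes pert: "perturbation lam Z" and lam: "lam \<noteq> 0"
    and Q: "Q = along Eul P - const m * P"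
    and eq: "along Z Q = (const (lam * m) + D) * Q" and D: "D \<in> mideal"
  shows "Q = 0"
proof (rule ord_ge_all_0)
  fix n
  show "ord_ge n Q"
  proof (induction n)
    case (Suc n)
    have "ord_ge (Suc n) (D * Q)"
      using ord_ge_mult [of "Suc 0" D n Q] Suc D by (simp add: ord_ge_1)
    moreover note perturbation_along [OF pert Suc]
    ultimately have "ord_ge (Suc n) (D * Q - (along Z Q - const lam * along Eul Q))"
      by (rule ord_ge_diff)
    moreover have "D * Q - (along Z Q - const lam * along Eul Q) = const lam * (along Eul Q - const m * Q)"
      unfolding eq by (simp add: const_mult algebra_simps)
    ultimately have E: "ord_ge (Suc n) (const lam * (along Eul Q - const m * Q))"
      by simp
    show ?case
      unfolding ord_ge_def
    proof (intro allI impI)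
      fix i j k assume "i + j + k < Suc n"
      with E have "cf (const lam * (along Eul Q - const m * Q)) i j k = 0"
        unfolding ord_ge_def by blast
      with lam have "(of_nat k - of_nat j - m) * cf Q i j k = 0"
        by (simp add: left_diff_distrib)
      moreover have "cf Q i j k = (of_nat k - of_nat j - m) * cf P i j k"
        by (simp add: Q left_diff_distrib)
      ultimately show "cf Q i j k = 0"
        by (metis mult_eq_0_iff)
    qed
  qed simp
qed

section \<open>The homological equation and the Poincare-Dulac theorem\<close>

definition diag :: "(nat \<Rightarrow> nat \<Rightarrow> nat \<Rightarrow> complex) \<Rightarrow> ser \<Rightarrow> ser" where
  "diag m f = ser_of (\<lambda>i j k. m i j k * cf f i j k)"

lemma cf_diag [simp]: "cf (diag m f) i j k = m i j k * cf f i j k"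
  by (simp add: diag_def)

lemma ord_ge_diag: "ord_ge n f \<Longrightarrow> ord_ge n (diag m f)"
  by (simp add: ord_ge_def)

lemma diag_diff: "diag m (f - g) = diag m f - diag m g"
  by (rule ser_eqI) (simp add: algebra_simps)

text \<open>Projection onto the eigenspace of \<open>Eul\<close> for the eigenvalue
  \<open>w\<close>.\<close>

definition res_part :: "complex \<Rightarrow> ser \<Rightarrow> ser" where
  "res_part w = diag (\<lambda>i j k. if of_nat k - of_nat j = w then 1 else 0)"

text \<open>Inverse of the operator \<open>lam\<close> (E - \<open>w\<close>) on the complement of
  its kernel; on the kernel the value 0 is chosen.\<close>

definition solve_hom :: "complex \<Rightarrow> complex \<Rightarrow> ser \<Rightarrow> ser" where
  "solve_hom lam w = diag (\<lambda>i j k. if of_nat k - of_nat j = w then 0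
     else 1 / (lam * (of_nat k - of_nat j - w)))"

lemma homological_equation:
  assumes "lam \<noteq> 0"
  shows "const lam * along Eul (solve_hom lam w h) - const (lam * w) * solve_hom lam w h + res_part w h = h"
proof (rule ser_eqI)
  fix i j k
  show "cf (const lam * along Eul (solve_hom lam w h) - const (lam * w) * solve_hom lam w h
      + res_part w h) i j k = cf h i j k"
  proof (cases "of_nat k - of_nat j = w")
    case False
    define q where "q = of_nat k - of_nat j - w"
    have kj: "of_nat k - of_nat j = q + w" and q: "q \<noteq> 0" using False by (auto simp: q_def)
    show ?thesis
      unfolding solve_hom_def res_part_def cf_add cf_diff cf_const_mult cf_Eul cf_diag kj
      using q assms by (simp add: field_simps)
  qed (simp add: solve_hom_def res_part_def)
qed

lemma along_Eul_res_part: "along Eul (res_part w h) = const w * res_part w h"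
  by (rule ser_eqI) (simp add: res_part_def)

text \<open>With \<Phi> = id + f and Z = \<open>lam\<close> E + n, conjugacy in the component of
  weight w reads \<open>lam\<close> (E - w) f - n = \<open>rhs\<close>. Every term of
  \<open>rhs\<close> containing f or n gains an order. Splitting off the kernel of E - w determines
  f and n.\<close>

theorem poincare_dulac:
  assumes Y: "perturbation lam Y" and lam: "lam \<noteq> 0" and Yx: "Y Cx = var Cx ^ 2"
  obtains \<Phi> Z where "near_id \<Phi>" "\<Phi> Cx = var Cx" "intertwines \<Phi> Y Z"
    "resonant Z" "perturbation lam Z"
proof -
  \<comment> \<open>The unknowns at \<open>True\<close> are the components of f, those at
    \<open>False\<close> the components of n.\<close>
  define \<Phi> :: "(bool \<times> coord \<Rightarrow> ser) \<Rightarrow> coord \<Rightarrow> ser" where "\<Phi> u c = var c + u (True, c)" for u c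
  \<comment> \<open>In the x component the value is prescribed: it yields f = 0 and n = x^2 there,
    since x^2 has weight 0. Hence the map fixes x.\<close>
  define rhs where "rhs u c = (if c = Cx then - (var Cx ^ 2) else
      (subst (u (False, c)) (\<Phi> u) - u (False, c))
      - (along Y (u (True, c)) - const lam * along Eul (u (True, c)))
      - (Y c - const (lam * wt c) * var c))" for u c
  define T where "T u = (\<lambda>(b, c). if b then solve_hom lam (wt c) (rhs u c) else - res_part (wt c) (rhs u c))"
    for u
  have near: "near_id (\<Phi> u)" if "\<And>i. ord_ge 2 (u i)" for u
    using that by (simp add: near_id_def \<Phi>_def)
  have x2: "ord_ge 2 (var Cx ^ 2)"
    by (rule ord_ge_power) simp
  obtain u where u: "\<And>i. ord_ge 2 (u i)" and fp: "T u = u"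
  proof (rule contraction_fixpoint [of T])
    fix u :: "bool \<times> coord \<Rightarrow> ser" and i assume u: "\<And>i. ord_ge 2 (u i)"
    have "ord_ge 2 (rhs u c)" for c
    proof (cases "c = Cx")
      case False
      have "ord_ge 2 (subst (u (False, c)) (\<Phi> u) - u (False, c))"
        by (rule ord_ge_mono [OF ord_ge_subst_near_id [OF near]]) (use u in auto)
      moreover have "ord_ge 2 (along Y (u (True, c)) - const lam * along Eul (u (True, c)))"
        by (rule ord_ge_mono [OF perturbation_along [OF Y]]) (use u in auto)
      moreover have "ord_ge 2 (Y c - const (lam * wt c) * var c)"
        using Y by (simp add: perturbation_def)
      ultimately show ?thesis
        using False unfolding rhs_def by (simp only: if_False ord_ge_diff)
    qed (simp add: rhs_def ord_ge_minus x2)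
    then show "ord_ge 2 (T u i)"
      by (cases i) (simp add: T_def solve_hom_def res_part_def ord_ge_diag ord_ge_minus)
  next
    fix u w :: "bool \<times> coord \<Rightarrow> ser" and m :: nat and i
    assume u: "\<And>i. ord_ge 2 (u i)" and w: "\<And>i. ord_ge 2 (w i)"
      and uw: "\<And>i. ord_ge m (u i - w i)" and m: "m \<ge> 2"
    have "ord_ge (Suc m) (rhs u c - rhs w c)" for c
    proof (cases "c = Cx")
      case False
      let ?n = "u (False, c)" and ?n' = "w (False, c)" and ?f = "u (True, c)" and ?f' = "w (True, c)"
      have 1: "ord_ge (Suc m) (subst (?n - ?n') (\<Phi> u) - (?n - ?n'))"
        by (rule ord_ge_subst_near_id [OF near]) (use u uw in auto)
      \<comment> \<open>The two maps differ only in order \<open>m\<close>, but \<open>?n'\<close>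
        has order 2, so altogether one order is gained.\<close>
      have "ord_ge ((m - 1) + 2) (subst ?n' (\<Phi> u) - subst ?n' (\<Phi> w))"
      proof (rule ord_ge_subst_diff)
        show "ord_ge (Suc (m - 1)) (\<Phi> u c - \<Phi> w c)" for c
          using uw [of "(True, c)"] m by (simp add: \<Phi>_def)
      qed (use near_id_singular near u w in auto)
      then have 2: "ord_ge (Suc m) (subst ?n' (\<Phi> u) - subst ?n' (\<Phi> w))"
        using m by (simp add: ord_ge_mono)
      have 3: "ord_ge (Suc m) (along Y (?f - ?f') - const lam * along Eul (?f - ?f'))"
        by (rule perturbation_along [OF Y uw])
      have "rhs u c - rhs w c = (subst (?n - ?n') (\<Phi> u) - (?n - ?n'))
          + (subst ?n' (\<Phi> u) - subst ?n' (\<Phi> w))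
          - (along Y (?f - ?f') - const lam * along Eul (?f - ?f'))"
        using False by (simp add: rhs_def subst_diff along_diff algebra_simps)
      then show ?thesis using ord_ge_diff [OF ord_ge_add [OF 1 2] 3] by simp
    qed (simp add: rhs_def)
    moreover have "T u (b, c) - T w (b, c) = (if b then solve_hom lam (wt c) (rhs u c - rhs w c)
        else - res_part (wt c) (rhs u c - rhs w c))" for b c
      by (simp add: T_def solve_hom_def res_part_def diag_diff)
    ultimately show "ord_ge (Suc m) (T u i - T w i)"
      by (cases i) (simp add: solve_hom_def res_part_def ord_ge_diag ord_ge_minus)
  qed blast
  have f: "u (True, c) = solve_hom lam (wt c) (rhs u c)"
    and n: "u (False, c) = - res_part (wt c) (rhs u c)" for c
    using fun_cong [OF fp, of "(True, c)"] fun_cong [OF fp, of "(False, c)"] by (simp_all add: T_def)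
  have eq: "const lam * along Eul (u (True, c)) - const (lam * wt c) * u (True, c) - u (False, c) = rhs u c" for c
    using homological_equation [OF lam, of "wt c" "rhs u c"] by (simp add: f n)
  have rx: "rhs u Cx = - (var Cx ^ 2)" by (simp add: rhs_def)
  have cx2: "cf (var Cx ^ 2) i j k = (if i = 2 \<and> j = 0 \<and> k = 0 then 1 else 0)" for i j k
    using cf_monom [of 2 0 0] by (simp add: monom_def)
  have fx: "u (True, Cx) = 0"
    unfolding f rx by (rule ser_eqI) (simp add: solve_hom_def cx2)
  have nx: "u (False, Cx) = var Cx ^ 2"
    unfolding n rx by (rule ser_eqI) (simp add: res_part_def cx2)
  define Z where "Z c = const (lam * wt c) * var c + u (False, c)" for c
  note nu = near [OF u]
  show ?thesis
  proof (rule that [OF nu])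
    show \<Phi>x: "\<Phi> u Cx = var Cx" by (simp add: \<Phi>_def fx)
    show "intertwines (\<Phi> u) Y Z"
      unfolding intertwines_def
    proof
      fix c
      note s = near_id_singular [OF nu]
      show "along Y (\<Phi> u c) = subst (Z c) (\<Phi> u)"
      proof (cases "c = Cx")
        case True
        then show ?thesis
          by (simp add: \<Phi>x Z_def nx Yx subst_power s)
      next
        case False
        with eq [of c] show ?thesis
          unfolding rhs_def Z_def
          by (simp add: subst_add subst_mult s) (simp add: \<Phi>_def along_add algebra_simps)
      qed
    qed
    show "resonant Z"
      unfolding resonant_def Z_def n
      by (simp add: along_diff along_mult along_Eul_res_part Eul_def) (simp add: algebra_simps)
    show "perturbation lam Z"
      by (simp add: perturbation_def Z_def u)
  qed
qed

section \<open>Substitution into series in one variable\<close>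

definition ser_x :: "complex fps \<Rightarrow> ser" where
  "ser_x c = Abs_fps (\<lambda>n. fps_const (fps_const (fps_nth c n)))"

lemma cf_ser_x: "cf (ser_x c) i j k = (if j = 0 \<and> k = 0 then fps_nth c i else 0)"
  by (simp add: cf_def ser_x_def)

text \<open>This transfers multiplicativity and the chain rule from \<open>subst\<close>. Sending
  all three variables to \<open>v\<close> is harmless, because \<open>ser_x c\<close> involves x
  only.\<close>

lemma subst1_eq: "subst1 c v = subst (ser_x c) (\<lambda>_. v)"
proof (rule ser_eqI)
  fix i j k :: nat
  have "cf (subst (ser_x c) (\<lambda>_. v)) i j k = (\<Sum>a\<le>i+j+k. \<Sum>b\<le>i+j+k. if b = 0 then
      \<Sum>d\<le>i+j+k. if d = 0 then fps_nth c a * cf (v ^ a) i j k else 0 else 0)"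
    unfolding cf_subst
    by (intro sum.cong refl) (auto simp: cf_ser_x subst_monom_def mult_delta_left intro!: sum.neutral)
  then show "cf (subst1 c v) i j k = cf (subst (ser_x c) (\<lambda>_. v)) i j k"
    by (simp add: subst1_def) (simp add: cf_def)
qed

lemma cf_subst1: "cf (subst1 c v) i j k = (\<Sum>n\<le>i+j+k. fps_nth c n * cf (v ^ n) i j k)"
  by (simp add: subst1_def cf_def)

lemma subst1_0000 [simp]: "cf (subst1 c v) 0 0 0 = fps_nth c 0"
  by (simp add: cf_subst1 cf_1)

lemma ser_x_mult: "ser_x (c * d) = ser_x c * ser_x d"
proof (rule fps_ext)
  have *: "fps_const (fps_const (sum h A)) = (\<Sum>a\<in>A. fps_const (fps_const (h a)))"
    for h :: "nat \<Rightarrow> complex" and A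
    by (induction A rule: infinite_finite_induct) (simp_all flip: fps_const_add)
  show "fps_nth (ser_x (c * d)) n = fps_nth (ser_x c * ser_x d) n" for n
    by (simp add: ser_x_def fps_mult_nth *)
qed

context
  fixes v :: ser
  assumes v: "v \<in> mideal"
begin

lemma singular_v [simp]: "singular (\<lambda>_. v)"
  using v by (simp add: singular_def)

lemma subst1_mult: "subst1 (c * d) v = subst1 c v * subst1 d v"
  by (simp add: subst1_eq ser_x_mult subst_mult)

lemma subst1_const [simp]: "subst1 (fps_const a) v = const a"
proof -
  have "ser_x (fps_const a) = const a"
    by (rule ser_eqI) (simp add: cf_ser_x cf_const)
  then show ?thesis by (simp add: subst1_eq)
qed

lemma subst1_1 [simp]: "subst1 1 v = 1"
  using subst1_const [of 1] by simp

lemma subst1_X [simp]: "subst1 fps_X v = v"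
proof -
  have "ser_x fps_X = var Cx"
    by (rule ser_eqI) (simp add: cf_ser_x cf_var fps_X_def)
  then show ?thesis by (simp add: subst1_eq)
qed

lemma pderiv_subst1: "pderiv c (subst1 d v) = subst1 (fps_deriv d) v * pderiv c v"
proof -
  have "pderiv Cx (ser_x d) = ser_x (fps_deriv d)" "pderiv Cy1 (ser_x d) = 0" "pderiv Cy2 (ser_x d) = 0"
    by (rule ser_eqI; simp add: cf_ser_x cf_pderiv)+
  then show ?thesis by (simp add: subst1_eq pderiv_subst_eq)
qed

lemma along_subst1: "along Y (subst1 d v) = subst1 (fps_deriv d) v * along Y v"
  by (simp add: along_eq pderiv_subst1 algebra_simps)

lemma subst_subst1: "singular \<Phi> \<Longrightarrow> subst (subst1 c v) \<Phi> = subst1 c (subst v \<Phi>)"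
  by (simp add: subst1_eq subst_subst dcomp_def)

end

lemma subst1_add: "subst1 (c + d) v = subst1 c v + subst1 d v"
  and subst1_diff: "subst1 (c - d) v = subst1 c v - subst1 d v"
  and subst1_minus: "subst1 (- c) v = - subst1 c v"
  by (rule ser_eqI; simp add: cf_subst1 ring_distribs sum.distrib sum_subtractf sum_negf)+

text \<open>The inverse is the geometric series 1/(1 + X) evaluated at \<open>P - 1\<close>.\<close>

lemma inverse_ser:
  assumes "cf P 0 0 0 = 1"
  obtains W where "P * W = 1" "cf W 0 0 0 = 1"
proof -
  have m: "P - 1 \<in> mideal" using assms by (simp add: mideal_def cf_1)
  let ?W = "subst1 (inverse (1 + fps_X)) (P - 1)"
  have "(1 + fps_X) * inverse (1 + fps_X :: complex fps) = 1"
    by (rule inverse_mult_eq_1') simp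
  then have "subst1 (1 + fps_X) (P - 1) * ?W = 1"
    by (simp add: m flip: subst1_mult [OF m])
  moreover have "subst1 (1 + fps_X) (P - 1) = P"
    using m by (simp add: subst1_add)
  ultimately show ?thesis
    using that [of ?W] by simp
qed

section \<open>Correction of the volume form\<close>

lemma subst_inject:
  assumes "\<Phi> \<in> Diff" "subst f \<Phi> = subst g \<Phi>" shows "f = g"
proof -
  have "subst (subst f \<Phi>) (dinv \<Phi>) = subst (subst g \<Phi>) (dinv \<Phi>)" using assms by simp
  with assms(1) show ?thesis
    by (simp add: subst_subst Diff_singular singular_dinv dcomp_dinv)
qed

lemma ord_ge_subst_iff:
  assumes "\<Phi> \<in> Diff" shows "ord_ge n (subst f \<Phi>) \<longleftrightarrow> ord_ge n f"
proof
  assume "ord_ge n (subst f \<Phi>)"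
  then have "ord_ge n (subst (subst f \<Phi>) (dinv \<Phi>))"
    by (rule ord_ge_subst [OF singular_dinv [OF assms]])
  with assms show "ord_ge n f"
    by (simp add: subst_subst Diff_singular singular_dinv dcomp_dinv)
qed (simp add: assms Diff_singular ord_ge_subst)

lemma intertwines_Cx:
  assumes "\<Phi> \<in> Diff" "\<Phi> Cx = var Cx" "intertwines \<Phi> Y Z"
  shows "Y Cx = var Cx ^ 2 \<longleftrightarrow> Z Cx = var Cx ^ 2"
proof -
  note s = Diff_singular [OF assms(1)]
  have "Y Cx = subst (Z Cx) \<Phi>" using intertwinesD [OF assms(3), of Cx] assms(2) by simp
  moreover have "subst (var Cx ^ 2) \<Phi> = var Cx ^ 2" by (simp add: subst_power s assms(2))
  ultimately show ?thesis using subst_inject [OF assms(1)] by metis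
qed

text \<open>When the Jacobian is 1, \<open>divy_intertwines\<close> transports the divergence as a
  function, and \<Phi> fixes x.\<close>

lemma divy_sympl:
  assumes \<Phi>: "sympl \<Phi>" and int: "intertwines \<Phi> Y Z" and Yx: "Y Cx = var Cx ^ 2"
    and div: "divy Y = var Cx"
  shows "divy Z = var Cx"
proof -
  have \<Phi>': "\<Phi> \<in> Diff" "\<Phi> Cx = var Cx" "jac \<Phi> = 1" using \<Phi> by (auto simp: sympl_def)
  have "subst (divy Z) \<Phi> = subst (var Cx) \<Phi>"
    using divy_intertwines [OF Diff_singular [OF \<Phi>'(1)] \<Phi>'(2) int] \<Phi>'
    by (simp add: Yx div power2_eq_square pderiv_mult pderiv_var Diff_singular)
  with \<Phi>' show ?thesis by (rule_tac subst_inject)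
qed

lemma perturbation_near_id:
  assumes near: "near_id \<Phi>" and int: "intertwines \<Phi> Y Z" and Y: "perturbation lam Y"
  shows "perturbation lam Z"
  unfolding perturbation_def
proof
  fix c
  note D = near_id_Diff [OF near] and s = near_id_singular [OF near]
  define f where "f = \<Phi> c - var c"
  have f: "ord_ge 2 f" "\<Phi> c = var c + f" using near by (auto simp: near_id_def f_def)
  have "subst (Z c - const (lam * wt c) * var c) \<Phi> = along Y (\<Phi> c) - const (lam * wt c) * \<Phi> c"
    by (simp add: subst_diff subst_mult s intertwinesD [OF int])
  also have "\<dots> = (Y c - const (lam * wt c) * var c) + (along Y f - const (lam * wt c) * f)"
    by (simp add: f(2) along_add algebra_simps)
  finally have "subst (Z c - const (lam * wt c) * var c) \<Phi> = \<dots>" .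
  moreover have "ord_ge 2 \<dots>"
    using Y f(1)
    by (intro ord_ge_add ord_ge_diff [of _ "along Y f"] perturbation_along_ord [OF Y] ord_ge_const_mult)
      (auto simp: perturbation_def)
  ultimately show "ord_ge 2 (Z c - const (lam * wt c) * var c)"
    using ord_ge_subst_iff [OF D] by metis
qed

text \<open>\<Phi> carries E to itself, so commutation with E is carried from Y to Z. The identity
  is checked after substituting \<Phi>, which is injective.\<close>

lemma resonant_image:
  assumes \<Phi>: "\<Phi> \<in> Diff" and int: "intertwines \<Phi> Y Z" and Y: "resonant Y" and res: "resonant \<Phi>"
  shows "resonant Z"
  unfolding resonant_def
proof
  fix c
  note s = Diff_singular [OF \<Phi>]
  have E: "intertwines \<Phi> Eul Eul"
    using res by (simp add: intertwines_def resonant_def Eul_def subst_mult s)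
  have "subst (along Eul (Z c)) \<Phi> = along Eul (along Y (\<Phi> c))"
    by (simp add: along_subst [OF s E] intertwinesD [OF int])
  also have "\<dots> = along Y (const (wt c) * \<Phi> c)"
    using res by (simp add: along_Eul_commute [OF Y] resonant_def)
  also have "\<dots> = subst (const (wt c) * Z c) \<Phi>"
    by (simp add: along_mult intertwinesD [OF int] subst_mult s)
  finally show "along Eul (Z c) = const (wt c) * Z c"
    by (rule subst_inject [OF \<Phi>])
qed

text \<open>Differentiation in y1 raises the eigenvalue of E by 1 and differentiation in y2 lowers
  it by 1. This cancels the weights -1 and 1 of the two components.\<close>

lemma along_Eul_divy:
  assumes "resonant Z" shows "along Eul (divy Z) = 0"
proof -
  have "pderiv Cy1 (along Eul f) = along Eul (pderiv Cy1 f) - pderiv Cy1 f"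
    "pderiv Cy2 (along Eul f) = along Eul (pderiv Cy2 f) + pderiv Cy2 f" for f
    by (simp_all add: pderiv_along Eul_def pderiv_mult pderiv_minus pderiv_var const_minus)
  from this(1) [of "Z Cy1"] this(2) [of "Z Cy2"] resonantD [OF assms] show ?thesis
    by (simp add: divy_def along_add pderiv_minus algebra_simps)
qed

lemma resonant_sympl_normalization:
  assumes Y: "perturbation lam Y" and lam: "lam \<noteq> 0" and Yx: "Y Cx = var Cx ^ 2"
    and div: "divy Y = var Cx"
  obtains \<Phi> Z where "sympl \<Phi>" "intertwines \<Phi> Y Z" "resonant Z" "perturbation lam Z"
    "Z Cx = var Cx ^ 2" "divy Z = var Cx"
proof -
  obtain \<Phi> Z where near: "near_id \<Phi>" and \<Phi>x: "\<Phi> Cx = var Cx" and int: "intertwines \<Phi> Y Z"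
    and Z: "resonant Z" "perturbation lam Z"
    using poincare_dulac [OF Y lam Yx] .
  note D = near_id_Diff [OF near] and s = near_id_singular [OF near]
  have Zx: "Z Cx = var Cx ^ 2" using intertwines_Cx [OF D \<Phi>x int] Yx by simp
  \<comment> \<open>The Jacobian is read in the target variables, so that its equation involves Z,
    which commutes with E.\<close>
  define P where "P = subst (jac \<Phi>) (dinv \<Phi>)"
  have P\<Phi>: "subst P \<Phi> = jac \<Phi>"
    by (simp add: P_def subst_subst s singular_dinv D dinv_dcomp)
  have "subst (along Z P) \<Phi> = subst ((divy Z - var Cx) * P) \<Phi>"
    using divy_intertwines [OF s \<Phi>x int]
    by (simp add: Yx div power2_eq_square pderiv_mult pderiv_var s \<Phi>x P\<Phi> subst_mult subst_diff
        algebra_simps flip: along_subst [OF s int])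
  then have ZP: "along Z P = (divy Z - var Cx) * P"
    by (rule subst_inject [OF D])
  have mid: "divy Z - var Cx \<in> mideal"
  proof -
    have "divy Z = pderiv Cy1 (Z Cy1 - const (lam * wt Cy1) * var Cy1)
        + pderiv Cy2 (Z Cy2 - const (lam * wt Cy2) * var Cy2)"
      by (simp add: divy_def pderiv_add pderiv_diff pderiv_mult pderiv_var const_minus)
    moreover have "ord_ge (Suc 0) \<dots>"
      using Z(2) unfolding perturbation_def numeral_2_eq_2 by (intro ord_ge_add ord_ge_pderiv) blast+
    ultimately show ?thesis
      unfolding ord_ge_1 [symmetric] by (metis ord_ge_diff ord_ge_var)
  qed
  \<comment> \<open>The factor \<open>divy Z - var Cx\<close> is annihilated by E, so E P satisfies
    the same equation as P; the factor has no constant term, which matches the eigenvalue 0.\<close>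
  have EP: "along Eul P = 0"
  proof (rule eigenvector_vanishes [OF Z(2) lam, of _ P 0])
    show "along Z (along Eul P) = (const (lam * 0) + (divy Z - var Cx)) * along Eul P"
      by (simp add: along_Eul_commute [OF Z(1), symmetric] ZP along_mult along_diff
          along_Eul_divy [OF Z(1)] Eul_def)
  qed (simp_all add: mid)
  have "cf P 0 0 0 = 1"
  proof -
    have "\<Phi> c = var c + (\<Phi> c - var c)" for c by simp
    moreover have "cf (pderiv c (\<Phi> d - var d)) 0 0 0 = 0" for c d
    proof -
      have "ord_ge (Suc 0) (pderiv c (\<Phi> d - var d))"
        using near by (intro ord_ge_pderiv) (simp add: near_id_def numeral_2_eq_2)
      then show ?thesis by (simp add: ord_ge_1 mideal_def)
    qed
    ultimately have "cf (pderiv c (\<Phi> d)) 0 0 0 = (if c = d then 1 else 0)" for c d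
      by (metis (mono_tags) pderiv_add pderiv_var cf_add cf_1 cf_0 add.right_neutral)
    then have "cf (jac \<Phi>) 0 0 0 = 1"
      by (simp add: jac_def cf_mult)
    then have "ord_ge (Suc 0) (jac \<Phi> - 1)" by (simp add: ord_ge_1 mideal_def cf_1)
    then have "ord_ge (Suc 0) (subst (jac \<Phi> - 1) (dinv \<Phi>))"
      by (intro ord_ge_subst singular_dinv D)
    then show ?thesis by (simp add: ord_ge_1 mideal_def P_def subst_diff singular_dinv D cf_1)
  qed
  then obtain W where W: "P * W = 1" "cf W 0 0 0 = 1" using inverse_ser by blast
  have "P * along Eul W = 0"
    using arg_cong [OF W(1), of "along Eul"] by (simp add: along_mult EP)
  with W(1) have EW: "along Eul W = 0" by auto
  \<comment> \<open>The antiderivative of \<open>W\<close> in y1 that vanishes at y1 = 0. Invariance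
    of \<open>W\<close> under E gives it the weight -1 of y1.\<close>
  define \<theta> where "\<theta> = var Cy1 * diag (\<lambda>i j k. 1 / of_nat (Suc j)) W"
  have \<theta>1: "pderiv Cy1 \<theta> = W"
    by (rule ser_eqI) (simp add: \<theta>_def cf_pderiv cf_var_mult del: of_nat_Suc)
  have E\<theta>: "along Eul \<theta> = - \<theta>"
  proof -
    have "along Eul (diag (\<lambda>i j k. 1 / of_nat (Suc j)) W) = 0"
    proof (rule ser_eqI)
      fix i j k
      have "cf (along Eul W) i j k = 0" by (simp only: EW cf_0)
      then show "cf (along Eul (diag (\<lambda>i j k. 1 / of_nat (Suc j)) W)) i j k = cf 0 i j k"
        by auto
    qed
    then show ?thesis by (simp add: \<theta>_def along_mult Eul_def const_minus)
  qed
  define \<Psi> where "\<Psi> = vf (var Cx) \<theta> (var Cy2)"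
  have \<Psi>near: "near_id \<Psi>"
    unfolding near_id_def
  proof
    fix c
    let ?u = "diag (\<lambda>i j k. 1 / of_nat (Suc j)) W - 1"
    have "ord_ge (Suc 0) ?u" by (simp add: ord_ge_1 mideal_def W cf_1)
    then have "ord_ge (Suc 0 + Suc 0) (var Cy1 * ?u)" by (intro ord_ge_mult ord_ge_var)
    moreover have "\<theta> - var Cy1 = var Cy1 * ?u" by (simp add: \<theta>_def algebra_simps)
    ultimately show "ord_ge 2 (\<Psi> c - var c)"
      by (cases c) (simp_all add: \<Psi>_def numeral_2_eq_2)
  qed
  have \<Psi>res: "resonant \<Psi>"
    unfolding resonant_def
  proof
    show "along Eul (\<Psi> c) = const (wt c) * \<Psi> c" for c
      by (cases c) (simp_all add: \<Psi>_def E\<theta> Eul_def const_minus)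
  qed
  note \<Psi>D = near_id_Diff [OF \<Psi>near] and \<Psi>s = near_id_singular [OF \<Psi>near]
  define Z' where "Z' = push \<Psi> Z"
  have int': "intertwines \<Psi> Z Z'" using push_eq_iff [OF \<Psi>D] Z'_def by blast
  have \<Psi>x: "\<Psi> Cx = var Cx" by (simp add: \<Psi>_def)
  have "jac \<Psi> = W" by (simp add: jac_def \<Psi>_def pderiv_var \<theta>1)
  \<comment> \<open>The Jacobian of \<Phi> is \<open>subst P \<Phi>\<close>, and \<open>W\<close> is
    the inverse of \<open>P\<close>; so the composite has Jacobian 1.\<close>
  then have "jac (dcomp \<Psi> \<Phi>) = subst (P * W) \<Phi>"
    by (simp add: jac_dcomp s \<Phi>x subst_mult P\<Phi>)
  then have sy: "sympl (dcomp \<Psi> \<Phi>)"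
    by (simp add: sympl_def dcomp_Diff D \<Psi>D W s) (simp add: dcomp_def \<Psi>x \<Phi>x s)
  have int2: "intertwines (dcomp \<Psi> \<Phi>) Y Z'"
    by (rule intertwines_dcomp [OF s \<Psi>s int int'])
  show ?thesis
  proof (rule that [OF sy int2])
    show "resonant Z'" by (rule resonant_image [OF \<Psi>D int' Z(1) \<Psi>res])
    show "perturbation lam Z'" by (rule perturbation_near_id [OF \<Psi>near int' Z(2)])
    show "Z' Cx = var Cx ^ 2" using intertwines_Cx [OF \<Psi>D \<Psi>x int'] Zx by simp
    \<comment> \<open>The divergence is carried by the composite directly from Y: neither of its two
      factors has been shown to be symplectic.\<close>
    show "divy Z' = var Cx" by (rule divy_sympl [OF sy int2 Yx div])
  qed
qed

section \<open>Normal forms\<close>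

abbreviation vv :: ser where "vv \<equiv> var Cy1 * var Cy2"

lemma vv_mideal [simp]: "vv \<in> mideal"
  by (simp add: mideal_def cf_var_mult)

lemma cf_subst1_vv: "cf (subst1 c vv) i j k = (if i = 0 \<and> j = k then fps_nth c j else 0)"
proof -
  have "vv ^ n = monom 0 n n" for n by (simp add: monom_def power_mult_distrib)
  then have "cf (subst1 c vv) i j k = (\<Sum>n\<le>i+j+k. if n = j then if i = 0 \<and> j = k then fps_nth c j else 0 else 0)"
    unfolding cf_subst1 by (intro sum.cong) (auto simp: cf_monom)
  then show ?thesis by simp
qed

lemma along_Eul_vv [simp]: "along Eul vv = 0"
  by (simp add: along_mult Eul_def const_minus)

lemma normal_form_simps:
  "normal_form lam a1 a2 c Cx = var Cx ^ 2"
  "normal_form lam a1 a2 c Cy1 = (- const lam + const a1 * var Cx - subst1 c vv) * var Cy1"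
  "normal_form lam a1 a2 c Cy2 = (const lam + const a2 * var Cx + subst1 c vv) * var Cy2"
  by (simp_all add: normal_form_def Let_def)

text \<open>A monomial of weight -1 has one more factor y1 than y2, which makes the first component
  divisible by y1. The shape of the second one comes from the divergence, in the form Z v = x
  v.\<close>

lemma resonant_quotient:
  assumes Z: "resonant Z" and div: "divy Z = var Cx"
  obtains B where "Z Cy1 = var Cy1 * B" "Z Cy2 = var Cy2 * (var Cx - B)" "along Eul B = 0"
proof -
  note E = resonantD [OF Z]
  define B where "B = ser_of (\<lambda>i j k. cf (Z Cy1) i (Suc j) k)"
  have Z1_0: "cf (Z Cy1) i 0 k = 0" for i k
  proof -
    have "cf (along Eul (Z Cy1)) i 0 k = - cf (Z Cy1) i 0 k" by (simp only: E cf_minus)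
    then have "of_nat (Suc k) * cf (Z Cy1) i 0 k = 0" by (simp add: algebra_simps)
    then show ?thesis by (simp del: of_nat_Suc)
  qed
  have Z1: "Z Cy1 = var Cy1 * B"
    by (rule ser_eqI) (simp add: cf_var_mult B_def Z1_0)
  have y: "var c \<noteq> 0" for c
    using pderiv_var [of c c] by (metis pderiv_0 zero_neq_one)
  have "var Cy1 * along Eul B = 0"
    using E(2) by (simp add: Z1 along_mult Eul_def const_minus)
  then have EB: "along Eul B = 0" using y by simp
  \<comment> \<open>This is Z v - x v. Its y1-derivative vanishes by the divergence and weight
    relations, and it vanishes at y1 = 0.\<close>
  define h where "h = var Cy2 * Z Cy1 + var Cy1 * Z Cy2 - var Cx * vv"
  have d1: "pderiv Cy1 (Z Cy1) = var Cx - pderiv Cy2 (Z Cy2)"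
    using div by (simp add: divy_def algebra_simps)
  have e2: "var Cy1 * pderiv Cy1 (Z Cy2) = var Cy2 * pderiv Cy2 (Z Cy2) - Z Cy2"
    using E(3) by (simp add: along_Eul algebra_simps)
  have "pderiv Cy1 h = var Cy2 * pderiv Cy1 (Z Cy1) + Z Cy2 + var Cy1 * pderiv Cy1 (Z Cy2) - var Cx * var Cy2"
    by (simp add: h_def pderiv_add pderiv_diff pderiv_mult pderiv_var algebra_simps)
  also have "\<dots> = 0" unfolding d1 e2 by (simp add: algebra_simps)
  finally have dh: "pderiv Cy1 h = 0" .
  have "h = 0"
  proof (rule ser_eqI)
    fix i j k
    show "cf h i j k = cf 0 i j k"
    proof (cases j)
      case 0
      then show ?thesis by (simp add: h_def cf_var_mult Z1_0 mult.left_commute [of "var Cx"])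
    next
      case (Suc l)
      have "cf (pderiv Cy1 h) i l k = 0" by (simp add: dh)
      then show ?thesis by (simp add: cf_pderiv Suc del: of_nat_Suc)
    qed
  qed
  then have "var Cy1 * Z Cy2 = var Cy1 * (var Cy2 * (var Cx - B))"
    by (simp add: h_def Z1 algebra_simps)
  then have "Z Cy2 = var Cy2 * (var Cx - B)" using y by simp
  with Z1 EB that show ?thesis by blast
qed

text \<open>The eigenvector equation expresses the y2-derivative through the y1-derivative. Then B
  drops out except in the term with \<open>m\<close>, and the rest is x times a degree
  operator.\<close>

lemma along_invariant:
  assumes "Z Cx = var Cx ^ 2" "Z Cy1 = var Cy1 * B" "Z Cy2 = var Cy2 * (var Cx - B)"
    and "along Eul f = const m * f"
  shows "along Z f = var Cx * (var Cx * pderiv Cx f + var Cy1 * pderiv Cy1 f) + const m * ((var Cx - B) * f)"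
proof -
  have e: "var Cy2 * pderiv Cy2 f = var Cy1 * pderiv Cy1 f + const m * f"
    using assms(4) by (simp add: along_Eul algebra_simps)
  have "along Z f = var Cx ^ 2 * pderiv Cx f + B * (var Cy1 * pderiv Cy1 f)
      + (var Cx - B) * (var Cy2 * pderiv Cy2 f)"
    by (simp add: along_eq assms algebra_simps)
  then show ?thesis unfolding e by (simp add: algebra_simps power2_eq_square)
qed

lemma cf_degree:
  "cf (var Cx * pderiv Cx f + var Cy1 * pderiv Cy1 f) i j k = (of_nat i + of_nat j) * cf f i j k"
  by (cases i; cases j) (simp_all add: cf_var_mult cf_pderiv algebra_simps)

text \<open>On invariants of \<open>Eul\<close> the field \<open>Z\<close> acts as \<open>x\<close> times a degree operator, because \<open>v / x\<close>
  is a first integral. This allows one to remove all terms of \<open>B\<close>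
  divisible by \<open>x\<close>, except the term linear in \<open>x\<close> alone.\<close>

lemma resonant_to_normal_form:
  assumes Z: "resonant Z" "perturbation lam Z" "Z Cx = var Cx ^ 2" "divy Z = var Cx"
  obtains \<Phi> a c where "sympl \<Phi>" "intertwines \<Phi> Z (normal_form lam a (1 - a) c)" "fps_nth c 0 = 0"
proof -
  obtain B where B: "Z Cy1 = var Cy1 * B" "Z Cy2 = var Cy2 * (var Cx - B)" "along Eul B = 0"
    using resonant_quotient [OF Z(1,4)] .
  \<comment> \<open>Chosen so that Z g cancels the terms of B divisible by x. The divisor
    \<open>i + j\<close> is the eigenvalue of the degree operator, and the factor x shifts the first
    index by one. Where the divisor would be 0, the term \<open>a\<close> x of B remains.\<close>
  define g where "g = ser_of (\<lambda>i j k. if j = k \<and> i + j \<noteq> 0 then - cf B (Suc i) j k / of_nat (i + j) else 0)"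
  define a where "a = cf B 1 0 0"
  \<comment> \<open>The terms of B free of x form the series in v; the sign comes from the term
    -c(v) in the first component.\<close>
  define c where "c = Abs_fps (\<lambda>n. if n = 0 then 0 else - cf B 0 n n)"
  have B0: "cf B 0 0 0 = - lam"
  proof -
    have "ord_ge 2 (Z Cy1 - const (lam * wt Cy1) * var Cy1)" using Z(2) unfolding perturbation_def by blast
    then have "cf (Z Cy1 - const (lam * wt Cy1) * var Cy1) 0 1 0 = 0" by (simp add: ord_ge_def)
    then show ?thesis by (simp add: B cf_var_mult cf_var const_minus eq_neg_iff_add_eq_0)
  qed
  have Boff: "cf B i j k = 0" if "j \<noteq> k" for i j k
  proof -
    have "cf (along Eul B) i j k = 0" by (simp only: B cf_0)
    with that show ?thesis by simp
  qed
  have Eg: "along Eul g = 0" by (rule ser_eqI) (simp add: g_def)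
  have g0: "g \<in> mideal" by (simp add: mideal_def g_def)
  have Zg: "B + along Z g = - const lam + const a * var Cx - subst1 c vv"
  proof (rule ser_eqI)
    fix i j k
    have "along Z g = var Cx * (var Cx * pderiv Cx g + var Cy1 * pderiv Cy1 g)"
      using along_invariant [OF Z(3) B(1,2), of g 0] Eg by simp
    then have "cf (along Z g) i j k = (if i = 0 then 0 else (of_nat (i - 1) + of_nat j) * cf g (i - 1) j k)"
      by (simp only: cf_var_mult(1) cf_degree)
    also have "\<dots> = (if i = 0 \<or> j \<noteq> k \<or> i = 1 \<and> j = 0 then 0 else - cf B i j k)"
      by (cases i) (auto simp: g_def simp flip: of_nat_add)
    finally have 1: "cf (along Z g) i j k = \<dots>" .
    show "cf (B + along Z g) i j k = cf (- const lam + const a * var Cx - subst1 c vv) i j k"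
      unfolding cf_add cf_diff cf_minus 1 cf_const_mult cf_var cf_const cf_subst1_vv
      by (auto simp: c_def a_def B0 Boff)
  qed
  \<comment> \<open>The exponentials of g and -g; their product is 1, so the map built from them
    preserves v.\<close>
  define s where "s = subst1 (fps_exp 1) g"
  define t where "t = subst1 (fps_exp (- 1)) g"
  have st: "s * t = 1"
    by (simp add: s_def t_def g0 flip: subst1_mult [OF g0] fps_exp_add_mult)
  have ds: "pderiv d s = s * pderiv d g" and dt: "pderiv d t = - (t * pderiv d g)"
    and as: "along Y s = s * along Y g" and at: "along Y t = - (t * along Y g)" for d Y
    by (simp_all add: s_def t_def pderiv_subst1 [OF g0] along_subst1 [OF g0] subst1_mult [OF g0] g0 const_minus)
  define \<Phi> where "\<Phi> = vf (var Cx) (var Cy1 * s) (var Cy2 * t)"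
  have near: "near_id \<Phi>"
    unfolding near_id_def
  proof
    fix d
    have s1: "ord_ge (Suc 0) (s - 1)" and t1: "ord_ge (Suc 0) (t - 1)"
      by (simp_all add: ord_ge_1 mideal_def s_def t_def cf_1)
    note ord_ge_mult [OF ord_ge_var s1, of Cy1] ord_ge_mult [OF ord_ge_var t1, of Cy2]
    then show "ord_ge 2 (\<Phi> d - var d)"
      by (cases d) (simp_all add: \<Phi>_def numeral_2_eq_2 algebra_simps)
  qed
  note D = near_id_Diff [OF near] and sg = near_id_singular [OF near]
  have \<Phi>x: "\<Phi> Cx = var Cx" by (simp add: \<Phi>_def)
  have "jac \<Phi> = s * t * (1 + (var Cy1 * pderiv Cy1 g - var Cy2 * pderiv Cy2 g))"
    by (simp add: jac_def \<Phi>_def pderiv_mult pderiv_var ds dt algebra_simps)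
  also have "var Cy1 * pderiv Cy1 g - var Cy2 * pderiv Cy2 g = 0"
    using Eg by (simp add: along_Eul)
  finally have "jac \<Phi> = 1" by (simp add: st)
  then have sy: "sympl \<Phi>" by (simp add: sympl_def D \<Phi>x)
  have "subst vv \<Phi> = vv * (s * t)"
    by (simp add: subst_mult sg) (simp add: \<Phi>_def mult_ac)
  then have cv: "subst (subst1 c vv) \<Phi> = subst1 c vv"
    by (simp add: subst_subst1 sg st)
  have "intertwines \<Phi> Z (normal_form lam a (1 - a) c)"
    unfolding intertwines_def
  proof
    fix d
    have 1: "along Z (\<Phi> Cy1) = (B + along Z g) * \<Phi> Cy1"
      by (simp add: \<Phi>_def along_mult B as algebra_simps)
    have 2: "along Z (\<Phi> Cy2) = (var Cx - (B + along Z g)) * \<Phi> Cy2"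
      by (simp add: \<Phi>_def along_mult B at algebra_simps)
    show "along Z (\<Phi> d) = subst (normal_form lam a (1 - a) c d) \<Phi>"
    proof (cases d)
      case Cx
      then show ?thesis by (simp add: \<Phi>x normal_form_simps subst_power sg Z)
    next
      case Cy1
      then show ?thesis
        unfolding Cy1 1 Zg normal_form_simps by (simp add: subst_mult subst_add subst_diff subst_minus sg cv \<Phi>x)
    next
      case Cy2
      then show ?thesis
        unfolding Cy2 2 Zg normal_form_simps
        by (simp add: subst_mult subst_add sg cv \<Phi>x) (simp add: const_diff algebra_simps)
    qed
  qed
  then show ?thesis using that [OF sy] by (simp add: c_def)
qed

section \<open>Uniqueness\<close>

lemma normal_form_resonant: "resonant (normal_form lam a1 a2 c)"
  unfolding resonant_def
proof
  show "along Eul (normal_form lam a1 a2 c d) = const (wt d) * normal_form lam a1 a2 c d" for d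
    by (cases d) (simp_all add: normal_form_simps along_power2 along_mult along_add along_diff along_minus
        along_subst1 Eul_def const_minus algebra_simps)
qed

lemma subst1_mideal: "fps_nth c 0 = 0 \<Longrightarrow> subst1 c v \<in> mideal"
  by (simp add: mideal_def)

lemma mideal_add: "f \<in> mideal \<Longrightarrow> g \<in> mideal \<Longrightarrow> f + g \<in> mideal"
  and mideal_diff: "f \<in> mideal \<Longrightarrow> g \<in> mideal \<Longrightarrow> f - g \<in> mideal"
  and mideal_mult: "g \<in> mideal \<Longrightarrow> f * g \<in> mideal"
  by (simp_all add: mideal_def cf_mult)

lemma ord_ge_2_mult: "f \<in> mideal \<Longrightarrow> g \<in> mideal \<Longrightarrow> ord_ge 2 (f * g)"
  using ord_ge_mult [of "Suc 0" f "Suc 0" g] by (simp add: ord_ge_1 numeral_2_eq_2)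

lemma normal_form_perturbation:
  assumes "fps_nth c 0 = 0" shows "perturbation lam (normal_form lam a1 a2 c)"
  unfolding perturbation_def
proof
  fix d
  have x2: "ord_ge 2 (var Cx ^ 2)" by (rule ord_ge_power) simp
  have m: "const a1 * var Cx - subst1 c vv \<in> mideal" "const a2 * var Cx + subst1 c vv \<in> mideal"
    by (intro mideal_add mideal_diff mideal_mult subst1_mideal assms; simp)+
  have "ord_ge 2 ((const a1 * var Cx - subst1 c vv) * var Cy1)"
    "ord_ge 2 ((const a2 * var Cx + subst1 c vv) * var Cy2)"
    by (intro ord_ge_2_mult m; simp)+
  with x2 show "ord_ge 2 (normal_form lam a1 a2 c d - const (lam * wt d) * var d)"
    by (cases d) (simp_all add: normal_form_simps const_minus algebra_simps)
qed

text \<open>The equations say that \<open>(x, \<theta>\<^sub>1, \<theta>\<^sub>2)\<close> intertwines the two normal forms.\<close>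

lemma normal_form_unique_same:
  fixes lam a1 a2 a1' a2' c c'
  defines "N \<equiv> normal_form lam a1 a2 c"
  assumes lam: "lam \<noteq> 0" and c: "fps_nth c 0 = 0" and a: "a1 + a2 = 1"
    and c': "fps_nth c' 0 = 0" and a': "a1' + a2' = 1"
    and m: "\<theta>1 \<in> mideal" "\<theta>2 \<in> mideal"
    and N1: "along N \<theta>1 = (- const lam + const a1' * var Cx - subst1 c' (\<theta>1 * \<theta>2)) * \<theta>1"
    and N2: "along N \<theta>2 = (const lam + const a2' * var Cx + subst1 c' (\<theta>1 * \<theta>2)) * \<theta>2"
    and lin: "cf \<theta>1 0 1 0 * cf \<theta>2 0 0 1 = 1"
  shows "a1' = a1 \<and> a2' = a2 \<and> c' = c"
proof -
  have res: "resonant N" and pert: "perturbation lam N"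
    by (simp_all add: N_def normal_form_resonant normal_form_perturbation c)
  define w where "w = \<theta>1 * \<theta>2"
  have w_m: "w \<in> mideal" by (simp add: w_def mideal_mult m)
  \<comment> \<open>In the product of the two equations the terms with \<open>lam\<close> and c'
    cancel; the sum of a1' and a2' remains.\<close>
  have "along N w = (const a1' + const a2') * (var Cx * w)"
    by (simp add: w_def along_mult N1 N2 algebra_simps)
  then have Nw: "along N w = var Cx * w"
    by (simp add: a' flip: const_add)
  have Ew: "along Eul w = 0"
  proof (rule eigenvector_vanishes [OF pert lam, of _ w 0])
    show "along N (along Eul w) = (const (lam * 0) + var Cx) * along Eul w"
      by (simp add: along_Eul_commute [OF res, symmetric] Nw along_mult Eul_def)
  qed simp_all
  \<comment> \<open>Since w is invariant under E, so is \<mu>. Hence E \<theta>1 + \<theta>1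
    satisfies the same equation as \<theta>1, and \<open>eigenvector_vanishes\<close> applies with
    eigenvalue -1.\<close>
  define \<mu> where "\<mu> = const a1' * var Cx - subst1 c' w"
  have \<mu>_m: "\<mu> \<in> mideal"
    by (simp add: \<mu>_def mideal_diff mideal_mult subst1_mideal c')
  have E\<mu>: "along Eul \<mu> = 0"
    by (simp add: \<mu>_def along_diff along_mult along_subst1 w_m Ew Eul_def)
  have N1': "along N \<theta>1 = (- const lam + \<mu>) * \<theta>1"
    by (simp add: N1 \<mu>_def w_def)
  have "along Eul \<theta>1 - const (-1) * \<theta>1 = 0"
  proof (rule eigenvector_vanishes [OF pert lam refl _ \<mu>_m])
    show "along N (along Eul \<theta>1 - const (-1) * \<theta>1) =
        (const (lam * (-1)) + \<mu>) * (along Eul \<theta>1 - const (-1) * \<theta>1)"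
      by (simp add: along_diff along_minus const_minus along_mult along_Eul_commute [OF res, symmetric] N1' along_add E\<mu>)
        (simp add: algebra_simps)
  qed
  then have E1: "along Eul \<theta>1 = const (-1) * \<theta>1" by simp
  define B where "B = - const lam + const a1 * var Cx - subst1 c vv"
  have N: "N Cx = var Cx ^ 2" "N Cy1 = var Cy1 * B" "N Cy2 = var Cy2 * (var Cx - B)"
  proof -
    have a2: "const a2 = 1 - const a1" using a by (metis const_1 const_diff add_diff_cancel_left')
    show "N Cx = var Cx ^ 2" "N Cy1 = var Cy1 * B" "N Cy2 = var Cy2 * (var Cx - B)"
      unfolding N_def normal_form_simps B_def a2 by (simp_all add: algebra_simps)
  qed
  have x: "var Cx \<noteq> 0"
    using pderiv_var [of Cx Cx] by (metis pderiv_0 zero_neq_one)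
  have "var Cx * (var Cx * pderiv Cx w + var Cy1 * pderiv Cy1 w) = var Cx * w"
    using along_invariant [OF N, of w 0] Ew Nw
    by (simp only: const_0 mult_zero_left add_0_right)
  then have wdeg: "var Cx * pderiv Cx w + var Cy1 * pderiv Cy1 w = w" using x by simp
  \<comment> \<open>Weight 0 and degree 1 in (x, y1) leave only the monomials x and v. The
    coefficient of x vanishes because both factors lie in the maximal ideal. That of v is given by
    \<open>lin\<close>, as \<theta>1 has no term in y2 alone.\<close>
  have w_eq: "w = vv"
  proof (rule ser_eqI)
    fix i j k
    have off: "(of_nat k - of_nat j) * cf w i j k = 0"
      using arg_cong [OF Ew, of "\<lambda>f. cf f i j k"] by simp
    have deg: "(of_nat i + of_nat j - 1) * cf w i j k = 0"
      using cf_degree [of w i j k] by (simp add: wdeg algebra_simps)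
    have \<theta>1_0: "cf \<theta>1 i 0 0 = 0" "cf \<theta>1 0 0 1 = 0" for i
      using arg_cong [OF E1, of "\<lambda>f. cf f i 0 0"] arg_cong [OF E1, of "\<lambda>f. cf f 0 0 1"] by simp_all
    have \<theta>0: "cf \<theta>1 0 0 0 = 0" "cf \<theta>2 0 0 0 = 0" using m by (auto simp: mideal_def)
    have w100: "cf w 1 0 0 = 0" and w011: "cf w 0 1 1 = 1"
      using \<theta>1_0 \<theta>0 lin by (simp_all add: w_def cf_mult)
    consider "j = k" "i + j = 1" | "cf w i j k = 0" "\<not> (j = k \<and> i + j = 1)"
      | "cf w i j k = 0" "j = k" "i + j = 1"
    proof -
      have "cf w i j k = 0" if "\<not> (j = k \<and> i + j = 1)"
        using that off deg by (metis (no_types) mult_eq_0_iff of_nat_1 of_nat_add of_nat_eq_iff eq_iff_diff_eq_0)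
      then show ?thesis using that by blast
    qed
    then show "cf w i j k = cf vv i j k"
    proof cases
      case 1
      then have "i = 1 \<and> j = 0 \<and> k = 0 \<or> i = 0 \<and> j = 1 \<and> k = 1" by auto
      then show ?thesis using w100 w011 by (auto simp: cf_var_mult cf_var)
    next
      case 2
      then show ?thesis by (auto simp: cf_var_mult cf_var)
    next
      case 3
      then have "i = 1 \<and> j = 0 \<and> k = 0 \<or> i = 0 \<and> j = 1 \<and> k = 1" by auto
      then show ?thesis using w100 w011 by (auto simp: cf_var_mult cf_var)
    qed
  qed
  define G where "G = var Cx * pderiv Cx \<theta>1 + var Cy1 * pderiv Cy1 \<theta>1 - \<theta>1"
  define h where "h = subst1 (c' - c) vv"
  have N1G: "along N \<theta>1 = var Cx * (G + \<theta>1) - (var Cx - B) * \<theta>1"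
    using along_invariant [OF N E1] by (simp add: const_minus G_def)
  have key: "var Cx * (const (a1' - a1) * \<theta>1 - G) = h * \<theta>1"
    using N1G unfolding N1' by (simp add: \<mu>_def B_def w_eq h_def subst1_diff const_diff algebra_simps)
  have nz: "cf \<theta>1 0 1 0 \<noteq> 0" using lin by auto
  \<comment> \<open>At x = 0 the left side of \<open>key\<close> vanishes, while \<theta>1 does not,
    by \<open>lin\<close>. As h is free of x, this gives c' = c.\<close>
  have "fps_nth h 0 * fps_nth \<theta>1 0 = 0"
    using arg_cong [OF key, of "\<lambda>f. fps_nth f 0"] by (simp add: var.simps)
  moreover have "fps_nth \<theta>1 0 \<noteq> 0" using nz by (auto simp: cf_def)
  ultimately have "cf h 0 n n = 0" for n by (simp add: cf_def)
  then have cc: "c' = c" by (intro fps_ext) (simp add: h_def cf_subst1_vv)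
  then have "h = 0" by (intro ser_eqI) (simp add: h_def cf_subst1)
  \<comment> \<open>G is the degree operator minus the identity applied to \<theta>1, which kills
    the monomial y1; comparing its coefficient gives a1' = a1.\<close>
  with key x have "const (a1' - a1) * \<theta>1 = G" by simp
  then have "(a1' - a1) * cf \<theta>1 0 1 0 = cf G 0 1 0" by (metis cf_const_mult)
  also have "cf G 0 1 0 = 0" unfolding G_def cf_diff [of _ \<theta>1] cf_degree by simp
  finally have "a1' = a1" using nz by simp
  moreover have "a2' = a2" using a a' \<open>a1' = a1\<close> by (metis add_left_cancel)
  ultimately show ?thesis using cc by blast
qed

text \<open>The swap of y1 and y2 with a sign sends v to -v; this is its effect on c.\<close>

lemma subst1_compose_uminus: "subst1 (fps_compose c (- fps_X)) v = subst1 c (- v)"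
  and nth_compose_uminus: "fps_nth (fps_compose c (- fps_X)) n = (-1) ^ n * fps_nth (c :: complex fps) n"
proof -
  have *: "fps_compose c (- fps_X) = Abs_fps (\<lambda>n. (-1) ^ n * fps_nth c n)" for c :: "complex fps"
    using fps_compose_linear [of c "-1"] by (simp flip: fps_const_neg)
  then show "fps_nth (fps_compose c (- fps_X)) n = (-1) ^ n * fps_nth c n" by simp
  have "cf ((- v) ^ n) i j k = (-1) ^ n * cf (v ^ n) i j k" for n i j k
    by (cases "even n") simp_all
  then show "subst1 (fps_compose c (- fps_X)) v = subst1 c (- v)"
    by (intro ser_eqI) (simp add: cf_subst1 * mult_ac)
qed

text \<open>Modulo order 2 the equations for \<theta>1 and \<theta>2 become eigenvalue equations for
  E. Since the determinant J is nonzero, lam' is lam or -lam, and the linear part in y1, y2 is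
  diagonal or antidiagonal accordingly.\<close>

lemma normal_form_unique:
  assumes lam: "lam \<noteq> 0" and c: "fps_nth c 0 = 0" and a: "a1 + a2 = 1"
    and lam': "lam' \<noteq> 0" and c': "fps_nth c' 0 = 0" and a': "a1' + a2' = 1"
    and \<Theta>: "sympl \<Theta>" "intertwines \<Theta> (normal_form lam a1 a2 c) (normal_form lam' a1' a2' c')"
  shows "(lam', a1', a2', c') = (lam, a1, a2, c) \<or>
    (lam', a1', a2', c') = (- lam, a2, a1, - fps_compose c (- fps_X))"
proof -
  let ?N = "normal_form lam a1 a2 c"
  define \<theta>1 \<theta>2 where "\<theta>1 = \<Theta> Cy1" and "\<theta>2 = \<Theta> Cy2"
  have D: "\<Theta> \<in> Diff" "\<Theta> Cx = var Cx" "jac \<Theta> = 1" using \<Theta> by (auto simp: sympl_def)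
  note s = Diff_singular [OF D(1)]
  have m: "\<theta>1 \<in> mideal" "\<theta>2 \<in> mideal" using s by (auto simp: singular_def \<theta>1_def \<theta>2_def)
  have sv: "subst (subst1 c' vv) \<Theta> = subst1 c' (\<theta>1 * \<theta>2)"
    by (simp add: subst_subst1 s subst_mult \<theta>1_def \<theta>2_def)
  have N1: "along ?N \<theta>1 = (- const lam' + const a1' * var Cx - subst1 c' (\<theta>1 * \<theta>2)) * \<theta>1"
    and N2: "along ?N \<theta>2 = (const lam' + const a2' * var Cx + subst1 c' (\<theta>1 * \<theta>2)) * \<theta>2"
    using intertwinesD [OF \<Theta>(2), of Cy1] intertwinesD [OF \<Theta>(2), of Cy2]
    by (simp_all add: normal_form_simps subst_mult subst_add subst_diff subst_minus s sv D(2)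
        flip: \<theta>1_def \<theta>2_def)
  have J: "cf \<theta>1 0 1 0 * cf \<theta>2 0 0 1 - cf \<theta>1 0 0 1 * cf \<theta>2 0 1 0 = 1"
    using arg_cong [OF D(3), of "\<lambda>f. cf f 0 0 0"]
    by (simp add: jac_def cf_mult cf_pderiv cf_1 \<theta>1_def \<theta>2_def)
  note pert = normal_form_perturbation [OF c, of lam a1 a2]
  have linear: "ord_ge 2 (const lam * along Eul \<theta> - const b * \<theta>)"
    if \<theta>: "\<theta> \<in> mideal" and \<mu>: "\<mu> \<in> mideal" and N: "along ?N \<theta> = (const b + \<mu>) * \<theta>" for \<theta> b \<mu>
  proof -
    have "ord_ge (Suc (Suc 0)) (along ?N \<theta> - const lam * along Eul \<theta>)"
      using \<theta> by (intro perturbation_along [OF pert]) (simp add: ord_ge_1)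
    then have "ord_ge 2 (\<mu> * \<theta> - (along ?N \<theta> - const lam * along Eul \<theta>))"
      using ord_ge_2_mult [OF \<mu> \<theta>] by (intro ord_ge_diff [of _ "\<mu> * \<theta>"]) (simp_all add: numeral_2_eq_2)
    moreover have "\<mu> * \<theta> - (along ?N \<theta> - const lam * along Eul \<theta>) = const lam * along Eul \<theta> - const b * \<theta>"
      by (simp add: N algebra_simps)
    ultimately show ?thesis by simp
  qed
  have l1: "ord_ge 2 (const lam * along Eul \<theta>1 - const (- lam') * \<theta>1)"
    by (rule linear [OF m(1), of "const a1' * var Cx - subst1 c' (\<theta>1 * \<theta>2)"])
      (simp_all add: mideal_diff mideal_mult subst1_mideal c' N1 const_minus algebra_simps)
  have l2: "ord_ge 2 (const lam * along Eul \<theta>2 - const lam' * \<theta>2)"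
    by (rule linear [OF m(2), of "const a2' * var Cx + subst1 c' (\<theta>1 * \<theta>2)"])
      (simp_all add: mideal_add mideal_mult subst1_mideal c' N2 algebra_simps)
  have eqs: "(lam' - lam) * cf \<theta>1 0 1 0 = 0" "(lam' + lam) * cf \<theta>1 0 0 1 = 0"
    "(lam' + lam) * cf \<theta>2 0 1 0 = 0" "(lam' - lam) * cf \<theta>2 0 0 1 = 0"
  proof -
    have "cf (const lam * along Eul \<theta>1 - const (- lam') * \<theta>1) 0 1 0 = 0"
      "cf (const lam * along Eul \<theta>1 - const (- lam') * \<theta>1) 0 0 1 = 0"
      "cf (const lam * along Eul \<theta>2 - const lam' * \<theta>2) 0 1 0 = 0"
      "cf (const lam * along Eul \<theta>2 - const lam' * \<theta>2) 0 0 1 = 0"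
      using l1 l2 by (auto simp only: ord_ge_def)
    then show "(lam' - lam) * cf \<theta>1 0 1 0 = 0" "(lam' + lam) * cf \<theta>1 0 0 1 = 0"
      "(lam' + lam) * cf \<theta>2 0 1 0 = 0" "(lam' - lam) * cf \<theta>2 0 0 1 = 0"
      unfolding cf_diff cf_const_mult cf_Eul by (auto simp: algebra_simps neg_eq_iff_add_eq_0)
  qed
  consider "lam' = lam" | "lam' = - lam"
    using eqs J by (metis add_eq_0_iff2 eq_iff_diff_eq_0 mult_eq_0_iff diff_zero mult_zero_left zero_neq_one)
  then show ?thesis
  proof cases
    case 1
    with eqs lam have "cf \<theta>1 0 0 1 = 0" by auto
    with J have lin: "cf \<theta>1 0 1 0 * cf \<theta>2 0 0 1 = 1" by simp
    from normal_form_unique_same [OF lam c a c' a' m N1 [unfolded 1] N2 [unfolded 1] lin] 1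
    show ?thesis by simp
  next
    case 2
    with eqs lam have "cf \<theta>1 0 1 0 = 0" by auto
    with J have lin: "cf (- \<theta>2) 0 1 0 * cf \<theta>1 0 0 1 = 1" by (simp add: mult.commute)
    \<comment> \<open>Composing with the inverse of the swap replaces the pair by -\<theta>2,
      \<theta>1 and the data by a2', a1', c''. This is the case of equal signs.\<close>
    define c'' where "c'' = - fps_compose c' (- fps_X)"
    have c'': "fps_nth c'' 0 = 0" by (simp add: c''_def nth_compose_uminus c')
    have sc: "subst1 c'' (- \<theta>2 * \<theta>1) = - subst1 c' (\<theta>1 * \<theta>2)"
      by (simp add: c''_def subst1_minus subst1_compose_uminus mult.commute)
    have "along ?N (- \<theta>2) = (- const lam + const a2' * var Cx - subst1 c'' (- \<theta>2 * \<theta>1)) * - \<theta>2"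
      unfolding sc by (simp add: along_minus N2 2 const_minus)
    moreover have "along ?N \<theta>1 = (const lam + const a1' * var Cx + subst1 c'' (- \<theta>2 * \<theta>1)) * \<theta>1"
      unfolding sc by (simp add: N1 2 const_minus)
    moreover have "- \<theta>2 \<in> mideal" using m by (simp add: mideal_def)
    moreover have "a2' + a1' = 1" using a' by (simp add: add.commute)
    ultimately have "a2' = a1 \<and> a1' = a2 \<and> c'' = c"
      using normal_form_unique_same [OF lam c a c'', of a2' a1' "- \<theta>2" \<theta>1] m lin by blast
    \<comment> \<open>The passage from c' to c'' is an involution.\<close>
    moreover have "c' = - fps_compose c'' (- fps_X)"
    proof (rule fps_ext)
      fix n
      have "(- 1 :: complex) ^ n * (- 1) ^ n = 1" by (simp flip: power_mult_distrib)
      then show "fps_nth c' n = fps_nth (- fps_compose c'' (- fps_X)) n"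
        by (simp add: nth_compose_uminus c''_def flip: mult.assoc)
    qed
    ultimately show ?thesis using 2 by simp
  qed
qed

section \<open>Prepared conjugates and their residue\<close>

lemma SN_omega_prepared:
  assumes Y: "Y \<in> D_omega" and conj: "conjugate_by Diff_omega Y Z" and Z: "prepared Z"
  obtains \<Phi> lam where "sympl \<Phi>" "intertwines \<Phi> Y Z" "lam \<noteq> 0" "perturbation lam Z"
    "Z Cx = var Cx ^ 2" "divy Z = var Cx"
proof -
  obtain \<Phi> where \<Phi>: "sympl \<Phi>" and push: "push \<Phi> Y = Z"
    using conj by (auto simp: conjugate_by_def Diff_omega_iff)
  then have D: "\<Phi> \<in> Diff" "\<Phi> Cx = var Cx" by (auto simp: sympl_def)
  have int: "intertwines \<Phi> Y Z" using push push_eq_iff [OF D(1)] by blast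
  obtain lam F1 F2 where lam: "lam \<noteq> 0" and F: "F1 \<in> mideal_sq" "F2 \<in> mideal_sq"
    and Zeq: "Z = vf (var Cx ^ 2) (- const lam * var Cy1 + F1) (const lam * var Cy2 + F2)"
    using Z by (auto simp: prepared_def)
  have Zx: "Z Cx = var Cx ^ 2" by (simp add: Zeq)
  \<comment> \<open>The divergence condition is known for Y, not for Z. So the x component x^2 is
    first pulled back to Y, and the divergence x is then pushed forward by \<Phi>.\<close>
  then have Yx: "Y Cx = var Cx ^ 2" using intertwines_Cx [OF D int] by simp
  have "divy Y = fps_shift 1 (var Cx * var Cx)"
    using D_omegaD(3) [OF Y] by (simp add: Yx power2_eq_square)
  also have "\<dots> = var Cx" by (rule fps_ext) (simp add: var.simps fps_X_nth)
  finally have "divy Y = var Cx" .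
  then have div: "divy Z = var Cx" by (rule divy_sympl [OF \<Phi> int Yx])
  have "ord_ge 2 (var Cx ^ 2)" by (rule ord_ge_power) simp
  then have "perturbation lam Z"
    unfolding perturbation_def
  proof (intro allI)
    show "ord_ge 2 (Z c - const (lam * wt c) * var c)" for c
      using F \<open>ord_ge 2 (var Cx ^ 2)\<close>
      by (cases c) (simp_all add: Zeq const_minus mideal_sq_ord_ge)
  qed
  with \<Phi> int lam Zx div that show ?thesis by blast
qed

text \<open>The trace of the matrix A(x) is the divergence restricted to y1 = y2 = 0.\<close>

lemma sn_residue_prepared_eq_1:
  assumes "divy Z = var Cx" shows "sn_residue_prepared Z = 1"
proof -
  have "linear_part Z Cy1 Cy1 + linear_part Z Cy2 Cy2 = fps_X"
  proof (rule fps_ext)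
    fix i
    have "cf (divy Z) i 0 0 = cf (var Cx) i 0 0" by (simp add: assms)
    then show "fps_nth (linear_part Z Cy1 Cy1 + linear_part Z Cy2 Cy2) i = fps_nth fps_X i"
      by (simp add: divy_def cf_pderiv cf_var fps_X_def)
  qed
  then show ?thesis by (simp add: sn_residue_prepared_def)
qed

text \<open>All prepared conjugates have the same residue and one exists, so the definite
  description denotes it.\<close>

lemma sn_residue_eq_1:
  assumes "Y \<in> SN_omega" shows "sn_residue Y = 1"
proof -
  have Y: "Y \<in> D_omega" and ex: "\<exists>Z. conjugate_by Diff_omega Y Z \<and> prepared Z"
    using assms by (auto simp: SN_omega_def)
  have "sn_residue_prepared Z = 1" if "conjugate_by Diff_omega Y Z" "prepared Z" for Z
    using SN_omega_prepared [OF Y that] sn_residue_prepared_eq_1 by metis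
  with ex show ?thesis
    unfolding sn_residue_def by (intro the_equality) auto
qed

theorem theorem1p12:
  fixes Y :: "coord \<Rightarrow> ser"
  assumes "Y \<in> SN_omega"
  shows "(\<exists>\<Phi>\<in>Diff_omega. \<exists>lam a1 a2 :: complex. \<exists>c :: complex fps.
            lam \<noteq> 0 \<and> fps_nth c 0 = 0 \<and> a1 + a2 = sn_residue Y \<and> sn_residue Y = 1 \<and>
            push \<Phi> Y = normal_form lam a1 a2 c) \<and>
         (\<forall>(lam::complex) a1 a2 (c::complex fps) (lam'::complex) a1' a2' (c'::complex fps).
            lam \<noteq> 0 \<and> fps_nth c 0 = 0 \<and> a1 + a2 = 1 \<and>
            lam' \<noteq> 0 \<and> fps_nth c' 0 = 0 \<and> a1' + a2' = 1 \<and>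
            conjugate_by Diff_omega Y (normal_form lam a1 a2 c) \<and>
            conjugate_by Diff_omega Y (normal_form lam' a1' a2' c') \<longrightarrow>
            (lam', a1', a2', c') = (lam, a1, a2, c) \<or>
            (lam', a1', a2', c') = (- lam, a2, a1, - fps_compose c (- fps_X)))"
proof (intro conjI allI impI)
  note res = sn_residue_eq_1 [OF assms]
  obtain Z where Y: "Y \<in> D_omega" and Z: "conjugate_by Diff_omega Y Z" "prepared Z"
    using assms by (auto simp: SN_omega_def)
  obtain \<Phi>0 lam where 0: "sympl \<Phi>0" "intertwines \<Phi>0 Y Z" and lam: "lam \<noteq> 0"
    and Zp: "perturbation lam Z" "Z Cx = var Cx ^ 2" "divy Z = var Cx"
    using SN_omega_prepared [OF Y Z] .
  obtain \<Phi>1 Z1 where 1: "sympl \<Phi>1" "intertwines \<Phi>1 Z Z1" and Z1: "resonant Z1" "perturbation lam Z1"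
    "Z1 Cx = var Cx ^ 2" "divy Z1 = var Cx"
    using resonant_sympl_normalization [OF Zp(1) lam Zp(2,3)] .
  obtain \<Phi>2 a c where 2: "sympl \<Phi>2" "intertwines \<Phi>2 Z1 (normal_form lam a (1 - a) c)"
    and c: "fps_nth c 0 = 0"
    using resonant_to_normal_form [OF Z1] .
  \<comment> \<open>The three maps lead to a prepared field, then to a field commuting with E, then
    to the normal form.\<close>
  define \<Phi> where "\<Phi> = dcomp \<Phi>2 (dcomp \<Phi>1 \<Phi>0)"
  have s: "singular \<Psi>" if "sympl \<Psi>" for \<Psi>
    using that Diff_singular by (auto simp: sympl_def)
  have \<Phi>: "sympl \<Phi>" unfolding \<Phi>_def by (intro sympl_dcomp 0 1 2)
  have "intertwines \<Phi> Y (normal_form lam a (1 - a) c)"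
    unfolding \<Phi>_def by (intro intertwines_dcomp [of _ _ Y Z1] intertwines_dcomp [of _ _ Y Z] s sympl_dcomp 0 1 2)
  then have "push \<Phi> Y = normal_form lam a (1 - a) c"
    using push_eq_iff \<Phi> by (auto simp: sympl_def)
  then show "\<exists>\<Phi>\<in>Diff_omega. \<exists>lam a1 a2 :: complex. \<exists>c :: complex fps.
      lam \<noteq> 0 \<and> fps_nth c 0 = 0 \<and> a1 + a2 = sn_residue Y \<and> sn_residue Y = 1 \<and>
      push \<Phi> Y = normal_form lam a1 a2 c"
    using \<Phi> lam c res by (intro bexI [of _ \<Phi>] exI [of _ lam] exI [of _ a] exI [of _ "1 - a"] exI [of _ c])
      (simp_all add: Diff_omega_iff)
next
  fix lam a1 a2 :: complex and c :: "complex fps" and lam' a1' a2' :: complex and c' :: "complex fps"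
  assume *: "lam \<noteq> 0 \<and> fps_nth c 0 = 0 \<and> a1 + a2 = 1 \<and>
    lam' \<noteq> 0 \<and> fps_nth c' 0 = 0 \<and> a1' + a2' = 1 \<and>
    conjugate_by Diff_omega Y (normal_form lam a1 a2 c) \<and>
    conjugate_by Diff_omega Y (normal_form lam' a1' a2' c')"
  then obtain \<Phi> \<Psi> where \<Phi>: "sympl \<Phi>" "push \<Phi> Y = normal_form lam a1 a2 c"
    and \<Psi>: "sympl \<Psi>" "push \<Psi> Y = normal_form lam' a1' a2' c'"
    by (auto simp: conjugate_by_def Diff_omega_iff)
  then have D: "\<Phi> \<in> Diff" "\<Psi> \<in> Diff" by (auto simp: sympl_def)
  \<comment> \<open>Passing through Y yields a symplectic conjugacy between the two normal forms
    themselves.\<close>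
  have "intertwines (dinv \<Phi>) (normal_form lam a1 a2 c) Y"
    using \<Phi> D push_eq_iff by (intro intertwines_dinv) auto
  moreover have "intertwines \<Psi> Y (normal_form lam' a1' a2' c')"
    using \<Psi> D push_eq_iff by auto
  ultimately have "intertwines (dcomp \<Psi> (dinv \<Phi>)) (normal_form lam a1 a2 c) (normal_form lam' a1' a2' c')"
    by (intro intertwines_dcomp singular_dinv Diff_singular D)
  moreover have "sympl (dcomp \<Psi> (dinv \<Phi>))"
    by (intro sympl_dcomp sympl_dinv \<Phi> \<Psi>)
  ultimately show "(lam', a1', a2', c') = (lam, a1, a2, c) \<or>
      (lam', a1', a2', c') = (- lam, a2, a1, - fps_compose c (- fps_X))"
    using * by (intro normal_form_unique) auto
qed

end
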